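(* Let $n\ge 2$ be an integer, $\lambda=\frac{n-1}{2}$, $m\in\mathbb N=\{1,2,\dots\}$, $a>0$, $r=e^{-a}$, and let $g_a^m$ be the Poisson wavelet of order $m$ at scale $a$ on $\mathcal S^n$. Then $g_a^m$ can be uniquely continued to a harmonic function over $\mathbb R^{n+1}\setminus\{r\hat e\}$. This continuation (again denoted $g_a^m$) is given for $x\in\mathbb R^{n+1}\setminus\{r\hat e\}$ by $$g_a^m(x)=\frac{a^m}{\Sigma_n}\sum_{l=0}^{m+1}l!\left(\alpha_l^m+\frac{\alpha_l^{m+1}}{\lambda}\right)e^{-al}\,\frac{C_l^\lambda(\cos\chi)}{|x-r\hat e|^{l+2\lambda}},\qquad \cos\chi=\frac{x-r\hat e}{|x-r\hat e|}\cdot\hat e,$$ where the coefficients $\alpha_l^m$ ($l,m\in\mathbb N_0$) are recursively given by $$\alpha_0^0=1,\qquad \alpha_0^m=0\ \text{ for } m\ge1,\qquad \alpha_l^m=0\ \text{ for } l>m,\qquad \alpha_l^{m+1}=l\,\alpha_l^m+\alpha_{l-1}^m\ \text{ for } l\ge 1.$$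
   Context: $\mathcal S^n$ is the unit sphere in $\mathbb R^{n+1}$, $\hat e=(1,0,\dots,0)$ its north pole, and $\Sigma_n=\frac{2\pi^{\lambda+1}}{\Gamma(\lambda+1)}$ its surface measure. The Gegenbauer polynomials $C_l^\lambda$ are defined by $\sum_{l=0}^\infty C_l^\lambda(t)\,r^l=(1-2tr+r^2)^{-\lambda}$ for $t\in[-1,1]$, $|r|<1$. Poisson kernel: for $0\le r<1$ and $y\in\mathcal S^n$ with $\cos\theta=\hat e\cdot y$, $$p_{r\hat e}(y)=\frac{1}{\Sigma_n}\frac{1-r^2}{(1-2r\cos\theta+r^2)^{(n+1)/2}}.$$ The Poisson wavelet of order $m\in\mathbb N$ at scale $a>0$ is the function on $\mathcal S^n$ $$g_a^m(y)=a^m\left[(r\partial_r)^m p_{r\hat e}(y)\right]_{r=e^{-a}}.$$ *)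

theory Defs
  imports "HOL-Analysis.Analysis"
begin

definition partial_deriv :: "'a::euclidean_space \<Rightarrow> ('a \<Rightarrow> real) \<Rightarrow> 'a \<Rightarrow> real" where
  "partial_deriv b f x = deriv (\<lambda>t. f (x + t *\<^sub>R b)) 0"

text \<open>
  For open \<open>S\<close> this is the usual class \<open>C\<^sup>2\<close>; continuity of \<open>f\<close> and of its first partial
  derivatives follows from their (Frechet) differentiability. Differentiability is required
  explicitly since \<^const>\<open>deriv\<close> is unspecified where the derivative does not exist.
\<close>

definition C2_on :: "'a::euclidean_space set \<Rightarrow> ('a \<Rightarrow> real) \<Rightarrow> bool" where
  "C2_on S f \<longleftrightarrow>
     f differentiable_on S \<and>
     (\<forall>b\<in>Basis. partial_deriv b f differentiable_on S) \<and>
     (\<forall>b\<in>Basis. \<forall>c\<in>Basis. continuous_on S (partial_deriv c (partial_deriv b f)))"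

definition laplacian :: "('a::euclidean_space \<Rightarrow> real) \<Rightarrow> 'a \<Rightarrow> real" where
  "laplacian f x = (\<Sum>b\<in>Basis. partial_deriv b (partial_deriv b f) x)"

definition harmonic_on :: "'a::euclidean_space set \<Rightarrow> ('a \<Rightarrow> real) \<Rightarrow> bool" where
  "harmonic_on S f \<longleftrightarrow> open S \<and> C2_on S f \<and> (\<forall>x\<in>S. laplacian f x = 0)"

text \<open>
  The Gegenbauer polynomials through their generating function. For \<open>t \<in> [-1,1]\<close> the base
  \<open>1 - 2tr + r\<^sup>2\<close> is positive, and the coefficient sequence exists and is unique; for other
  \<open>t\<close> the value is irrelevant.
\<close>

definition gegenbauer :: "real \<Rightarrow> nat \<Rightarrow> real \<Rightarrow> real" where
  "gegenbauer lam l t =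
     (THE c :: nat \<Rightarrow> real. \<forall>r. \<bar>r\<bar> < 1 \<longrightarrow>
        (\<lambda>k. c k * r ^ k) sums ((1 - 2 * t * r + r\<^sup>2) powr (- lam))) l"

definition sphere_area :: "nat \<Rightarrow> real" where
  "sphere_area n =
     (let lam = (real n - 1) / 2 in 2 * pi powr (lam + 1) / Gamma (lam + 1))"

text \<open>Here \<open>e\<close> is the north pole and \<open>e \<bullet> y = cos \<theta>\<close>.\<close>

definition poisson_kernel :: "nat \<Rightarrow> 'a::euclidean_space \<Rightarrow> real \<Rightarrow> 'a \<Rightarrow> real" where
  "poisson_kernel n e r y =
     1 / sphere_area n * ((1 - r\<^sup>2) / (1 - 2 * r * (e \<bullet> y) + r\<^sup>2) powr ((real n + 1) / 2))"

text \<open>The operator \<open>r \<partial>\<^sub>r\<close>.\<close>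

definition euler_op :: "(real \<Rightarrow> real) \<Rightarrow> real \<Rightarrow> real" where
  "euler_op f r = r * deriv f r"

definition poisson_wavelet :: "nat \<Rightarrow> 'a::euclidean_space \<Rightarrow> nat \<Rightarrow> real \<Rightarrow> 'a \<Rightarrow> real" where
  "poisson_wavelet n e m a y =
     a ^ m * (euler_op ^^ m) (\<lambda>r. poisson_kernel n e r y) (exp (- a))"

text \<open>
  \<open>alpha l m\<close> is the coefficient with lower index \<open>l\<close> and upper index \<open>m\<close>. The condition that it
  vanishes for \<open>l > m\<close> enters the recursion only for \<open>m = 0\<close>; the other cases follow.
\<close>

fun alpha :: "nat \<Rightarrow> nat \<Rightarrow> real" where
  "alpha 0 0 = 1"
| "alpha 0 (Suc m) = 0"
| "alpha (Suc l) 0 = 0"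
| "alpha (Suc l) (Suc m) = real (Suc l) * alpha (Suc l) m + alpha l m"

lemma alpha_eq_0: "l > m \<Longrightarrow> alpha l m = 0"
  by (induction l m rule: alpha.induct) auto

definition harmonic_continuation ::
    "'a::euclidean_space set \<Rightarrow> 'a set \<Rightarrow> ('a \<Rightarrow> real) \<Rightarrow> ('a \<Rightarrow> real) \<Rightarrow> bool" where
  "harmonic_continuation A D g h \<longleftrightarrow> A \<subseteq> D \<and> harmonic_on D h \<and> (\<forall>y\<in>A. h y = g y)"

end

theory Submission
  imports Defs "HOL-Complex_Analysis.Cauchy_Integral_Formula"
begin

text \<open>
  Write \<open>N = n + 1\<close> for the dimension, \<open>p = r *\<^sub>R e\<close>, and \<open>\<lambda> = (N - 2) / 2\<close>, so that
  \<open>norm x powr (- 2 * \<lambda>)\<close> is the Newtonian kernel.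

  \<^bold>\<open>Existence and the formula.\<close> On the sphere the Poisson kernel with pole \<open>\<rho> *\<^sub>R e\<close> is
  \<open>(1 + \<rho> \<partial>\<^sub>\<rho> / \<lambda>)\<close> applied to \<open>norm (y - \<rho> *\<^sub>R e) powr (- 2 * \<lambda>)\<close> (\<open>poisson_kernel_eq_multipole\<close>).
  Expanding \<open>(\<rho> \<partial>\<^sub>\<rho>) ^ m\<close> with Stirling numbers (\<open>euler_op_iter_poisson\<close>) writes the wavelet as a combination
  of the derivatives of the Newtonian kernel with respect to its pole. These multipole fields are
  derivatives of a harmonic function, hence harmonic off the pole
  (\<open>harmonic_partial_deriv\<close>, \<open>harmonic_multipole\<close>), and Taylor expansion in the pole is the generating function of the
  Gegenbauer polynomials (\<open>multipole_eq_gegenbauer\<close>).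

  \<^bold>\<open>Uniqueness.\<close> Let \<open>u\<close> be harmonic off \<open>p\<close> and zero on the unit sphere. By odd reflection,
  \<open>u x = - norm x powr (- 2 * \<lambda>) * u (x /\<^sub>R (norm x)\<^sup>2)\<close> along every ray that avoids \<open>p\<close>
  (\<open>harmonic_kelvin_odd\<close>). As \<open>u\<close> is regular at the mirror image of \<open>p\<close>, it is bounded
  near \<open>p\<close>; comparison with the Newtonian kernel shows that \<open>u\<close> vanishes in the ball
  (\<open>harmonic_bounded_puncture_eq_0\<close>), and then, by reflection, everywhere
  (\<open>harmonic_punctured_sphere_unique\<close>).

  The reflection principle rests on real-analyticity along rays. It is obtained from a mean value
  property (\<open>harmonic_mean_value\<close>) with respect to the \<open>C\<^sup>1\<close> radial kernel \<open>max 0 (1 - (norm z)\<^sup>2) ^ 2\<close>,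
  which turns surface integrals into volume integrals: differentiating this property gives the smoothness of harmonic functions
  and a gradient estimate, and iterating the estimate for the operator \<open>x \<bullet> \<nabla> + \<lambda>\<close>, the logarithmic
  radial derivative conjugated by a power of the radius, gives factorial bounds on all derivatives along
  a ray. Its even powers map \<open>u\<close> to functions vanishing on the sphere, which is the oddness in
  logarithmic radius.
\<close>

section \<open>Gradients and the harmonicity predicate\<close>

definition grad :: "('a::euclidean_space \<Rightarrow> real) \<Rightarrow> 'a \<Rightarrow> 'a" where
  "grad u x = (\<Sum>b\<in>Basis. partial_deriv b u x *\<^sub>R b)"

lemma grad_inner_Basis: "b \<in> Basis \<Longrightarrow> grad u x \<bullet> b = partial_deriv b u x"
  by (simp add: grad_def inner_sum_left inner_Basis if_distrib sum.delta cong: if_cong)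

lemma GDERIV_line:
  fixes u :: "'a::real_inner \<Rightarrow> real"
  assumes "GDERIV u (p + s *\<^sub>R v) :> D"
  shows "((\<lambda>t. u (p + t *\<^sub>R v)) has_real_derivative D \<bullet> v) (at s within T)"
proof -
  have "((\<lambda>t. p + t *\<^sub>R v) has_derivative (\<lambda>t. t *\<^sub>R v)) (at s within T)"
    by (auto intro!: derivative_eq_intros)
  from has_derivative_compose[OF this assms[unfolded gderiv_def]]
  show ?thesis
    by (auto simp: has_field_derivative_def fun_eq_iff inner_commute mult.commute elim!: has_derivative_eq_rhs)
qed

lemma partial_deriv_eq:
  assumes "GDERIV u x :> D"
  shows "partial_deriv b u x = D \<bullet> b"
proof -
  have "((\<lambda>t. u (x + t *\<^sub>R b)) has_real_derivative D \<bullet> b) (at 0)"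
    by (rule GDERIV_line) (use assms in simp)
  then show ?thesis unfolding partial_deriv_def by (rule DERIV_imp_deriv)
qed

lemma grad_eq:
  assumes "GDERIV u x :> D"
  shows "grad u x = D"
  by (rule euclidean_eqI) (simp add: grad_inner_Basis partial_deriv_eq[OF assms])

lemma differentiable_imp_GDERIV:
  fixes u :: "'a::euclidean_space \<Rightarrow> real"
  assumes "u differentiable (at x)"
  shows "GDERIV u x :> grad u x"
proof -
  obtain D where D: "(u has_derivative D) (at x)"
    using assms by (auto simp: differentiable_def)
  interpret D: bounded_linear D using D by (rule has_derivative_bounded_linear)
  have "D h = h \<bullet> (\<Sum>b\<in>Basis. D b *\<^sub>R b)" for h
  proof -
    have "D h = D (\<Sum>b\<in>Basis. (h \<bullet> b) *\<^sub>R b)" by (simp add: euclidean_representation)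
    also have "\<dots> = (\<Sum>b\<in>Basis. (h \<bullet> b) * D b)" by (simp add: D.sum D.scaleR)
    finally show ?thesis by (simp add: inner_sum_right mult.commute)
  qed
  then have "D = (\<lambda>h. h \<bullet> (\<Sum>b\<in>Basis. D b *\<^sub>R b))" by (rule ext)
  with D have "GDERIV u x :> (\<Sum>b\<in>Basis. D b *\<^sub>R b)"
    by (simp add: gderiv_def)
  then show ?thesis using grad_eq by metis
qed

lemma GDERIV_cong_open:
  assumes "GDERIV f x :> D" "open S" "x \<in> S" "\<And>y. y \<in> S \<Longrightarrow> f y = g y"
  shows "GDERIV g x :> D"
  using has_derivative_transform_within_open[of f _ x UNIV S g] assms by (simp add: gderiv_def)

text \<open>
  The second-order data of a harmonic function are handled as gradient vectors: \<open>U\<close> is the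
  gradient and \<open>V b\<close> the gradient of its \<open>b\<close>-th component, so that the Laplacian is the
  trace \<open>\<Sum>b. V b x \<bullet> b\<close>. This form avoids every reference to the \<^const>\<open>deriv\<close>-based
  partial derivatives when a function is given by a formula; the facts after it read the same data
  off a given harmonic function.
\<close>

lemma harmonic_onI:
  fixes u :: "'a::euclidean_space \<Rightarrow> real"
  assumes S: "open S"
    and U: "\<And>x. x \<in> S \<Longrightarrow> GDERIV u x :> U x"
    and V: "\<And>x b. x \<in> S \<Longrightarrow> b \<in> Basis \<Longrightarrow> GDERIV (\<lambda>x. U x \<bullet> b) x :> V b x"
    and cont: "\<And>b. b \<in> Basis \<Longrightarrow> continuous_on S (V b)"
    and trace: "\<And>x. x \<in> S \<Longrightarrow> (\<Sum>b\<in>Basis. V b x \<bullet> b) = 0"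
  shows "harmonic_on S u"
proof -
  have 1: "partial_deriv b u x = U x \<bullet> b" if "x \<in> S" for x b
    using partial_deriv_eq[OF U[OF that]] .
  have 2: "GDERIV (partial_deriv b u) x :> V b x" if "x \<in> S" "b \<in> Basis" for x b
    by (rule GDERIV_cong_open[OF V[OF that] S that(1)]) (simp add: 1)
  have 3: "partial_deriv c (partial_deriv b u) x = V b x \<bullet> c" if "x \<in> S" "b \<in> Basis" for x b c
    using partial_deriv_eq[OF 2[OF that]] .
  have "continuous_on S (partial_deriv c (partial_deriv b u))" if "b \<in> Basis" for b c
    using 3[OF _ that] cont[OF that]
    by (subst continuous_on_cong[OF refl, of _ _ "\<lambda>x. V b x \<bullet> c"]) (auto intro!: continuous_intros)
  moreover have "partial_deriv b u differentiable_on S" if "b \<in> Basis" for b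
    using 2[OF _ that] S
    by (auto simp: differentiable_on_eq_differentiable_at gderiv_def differentiable_def)
  moreover have "u differentiable_on S"
    using U S by (auto simp: differentiable_on_eq_differentiable_at gderiv_def differentiable_def)
  moreover have "laplacian u x = 0" if "x \<in> S" for x
    using 3[OF that] trace[OF that] by (simp add: laplacian_def)
  ultimately show ?thesis using S by (simp add: harmonic_on_def C2_on_def)
qed

lemma
  fixes u :: "'a::euclidean_space \<Rightarrow> real"
  assumes u: "harmonic_on S u"
  shows harmonic_on_open: "open S"
    and harmonic_on_GDERIV: "\<And>x. x \<in> S \<Longrightarrow> GDERIV u x :> grad u x"
    and harmonic_on_GDERIV2: "\<And>x b. x \<in> S \<Longrightarrow> b \<in> Basis \<Longrightarrow>
           GDERIV (partial_deriv b u) x :> grad (partial_deriv b u) x"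
    and harmonic_on_cont: "continuous_on S u"
    and harmonic_on_cont1: "continuous_on S (grad u)"
    and harmonic_on_cont2: "\<And>b. b \<in> Basis \<Longrightarrow> continuous_on S (grad (partial_deriv b u))"
    and harmonic_on_trace: "\<And>x. x \<in> S \<Longrightarrow> (\<Sum>b\<in>Basis. grad (partial_deriv b u) x \<bullet> b) = 0"
proof -
  have S: "open S" and c2: "C2_on S u" and l: "\<And>x. x \<in> S \<Longrightarrow> laplacian u x = 0"
    using u by (auto simp: harmonic_on_def)
  show "open S" by fact
  show 1: "\<And>x. x \<in> S \<Longrightarrow> GDERIV u x :> grad u x"
    and 2: "\<And>x b. x \<in> S \<Longrightarrow> b \<in> Basis \<Longrightarrow>
           GDERIV (partial_deriv b u) x :> grad (partial_deriv b u) x"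
    using c2 S by (auto simp: C2_on_def differentiable_on_eq_differentiable_at intro!: differentiable_imp_GDERIV)
  show "continuous_on S u" using c2 by (auto simp: C2_on_def differentiable_imp_continuous_on)
  show "continuous_on S (grad u)" unfolding grad_def
    using c2 by (intro continuous_on_sum continuous_on_scaleR continuous_on_const)
      (simp add: C2_on_def differentiable_imp_continuous_on)
  show "\<And>b. b \<in> Basis \<Longrightarrow> continuous_on S (grad (partial_deriv b u))" unfolding grad_def
    using c2 by (auto simp: C2_on_def intro!: continuous_intros)
  show "\<And>x. x \<in> S \<Longrightarrow> (\<Sum>b\<in>Basis. grad (partial_deriv b u) x \<bullet> b) = 0"
    using l by (simp add: laplacian_def grad_inner_Basis)
qed

lemma harmonic_on_locally:
  fixes u :: "'a::euclidean_space \<Rightarrow> real"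
  assumes "\<And>x. x \<in> S \<Longrightarrow> \<exists>T. x \<in> T \<and> T \<subseteq> S \<and> harmonic_on T u"
  shows "harmonic_on S u"
proof (rule harmonic_onI[where U = "grad u" and V = "\<lambda>b. grad (partial_deriv b u)"])
  show S: "open S" by (subst open_subopen) (use assms harmonic_on_open in blast)
  show "continuous_on S (grad (partial_deriv b u))" if b: "b \<in> Basis" for b
    unfolding continuous_on_eq_continuous_at[OF S]
    using assms harmonic_on_cont2[OF _ b] harmonic_on_open
    by (metis continuous_on_eq_continuous_at)
  fix x assume x: "x \<in> S"
  then obtain T where T: "x \<in> T" "T \<subseteq> S" "harmonic_on T u" using assms by blast
  show "GDERIV u x :> grad u x" using harmonic_on_GDERIV T by blast
  show "(\<Sum>b\<in>Basis. grad (partial_deriv b u) x \<bullet> b) = 0" using harmonic_on_trace T by blast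
  show "GDERIV (\<lambda>x. grad u x \<bullet> b) x :> grad (partial_deriv b u) x" if "b \<in> Basis" for b
    using harmonic_on_GDERIV2[OF T(3,1) that] by (simp add: grad_inner_Basis[OF that])
qed

lemma harmonic_on_cong:
  fixes u v :: "'a::euclidean_space \<Rightarrow> real"
  assumes u: "harmonic_on S u" and eq: "\<And>x. x \<in> S \<Longrightarrow> v x = u x"
  shows "harmonic_on S v"
proof (rule harmonic_onI[where U = "grad u" and V = "\<lambda>b. grad (partial_deriv b u)"])
  note S = harmonic_on_open[OF u]
  show "open S" by fact
  fix x assume x: "x \<in> S"
  show "GDERIV v x :> grad u x"
    by (rule GDERIV_cong_open[OF harmonic_on_GDERIV[OF u x] S x]) (simp add: eq)
  show "(\<Sum>b\<in>Basis. grad (partial_deriv b u) x \<bullet> b) = 0" using harmonic_on_trace u x by blast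
  show "GDERIV (\<lambda>x. grad u x \<bullet> b) x :> grad (partial_deriv b u) x" if "b \<in> Basis" for b
    using harmonic_on_GDERIV2[OF u x that] by (simp add: grad_inner_Basis[OF that])
qed (use u harmonic_on_cont2 in blast)

lemma harmonic_on_scale:
  fixes u :: "'a::euclidean_space \<Rightarrow> real"
  assumes u: "harmonic_on S u"
  shows "harmonic_on S (\<lambda>x. c * u x)"
proof (rule harmonic_onI[where U = "\<lambda>x. c *\<^sub>R grad u x" and V = "\<lambda>b x. c *\<^sub>R grad (partial_deriv b u) x"])
  show "open S" using harmonic_on_open[OF u] .
  fix x assume x: "x \<in> S"
  show "GDERIV (\<lambda>x. c * u x) x :> c *\<^sub>R grad u x"
    using GDERIV_mult[OF GDERIV_const[of c] harmonic_on_GDERIV[OF u x]] by simp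
  show "(\<Sum>b\<in>Basis. (c *\<^sub>R grad (partial_deriv b u) x) \<bullet> b) = 0"
    using harmonic_on_trace[OF u x] by (simp add: sum_distrib_left[symmetric])
  show "GDERIV (\<lambda>x. (c *\<^sub>R grad u x) \<bullet> b) x :> c *\<^sub>R grad (partial_deriv b u) x" if "b \<in> Basis" for b
    using GDERIV_mult[OF GDERIV_const[of c] harmonic_on_GDERIV2[OF u x that]]
    by (simp add: grad_inner_Basis[OF that])
qed (auto intro!: continuous_intros harmonic_on_cont2[OF u])

lemma harmonic_on_add:
  fixes u v :: "'a::euclidean_space \<Rightarrow> real"
  assumes u: "harmonic_on S u" and v: "harmonic_on S v"
  shows "harmonic_on S (\<lambda>x. u x + v x)"
proof (rule harmonic_onI[where U = "\<lambda>x. grad u x + grad v x" and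
      V = "\<lambda>b x. grad (partial_deriv b u) x + grad (partial_deriv b v) x"])
  show "open S" using harmonic_on_open[OF u] .
  fix x assume x: "x \<in> S"
  show "GDERIV (\<lambda>x. u x + v x) x :> grad u x + grad v x"
    using GDERIV_add[OF harmonic_on_GDERIV[OF u x] harmonic_on_GDERIV[OF v x]] .
  show "(\<Sum>b\<in>Basis. (grad (partial_deriv b u) x + grad (partial_deriv b v) x) \<bullet> b) = 0"
    using harmonic_on_trace[OF u x] harmonic_on_trace[OF v x] by (simp add: inner_add_left sum.distrib)
  show "GDERIV (\<lambda>x. (grad u x + grad v x) \<bullet> b) x :> grad (partial_deriv b u) x + grad (partial_deriv b v) x"
    if "b \<in> Basis" for b
    using GDERIV_add[OF harmonic_on_GDERIV2[OF u x that] harmonic_on_GDERIV2[OF v x that]]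
    by (simp add: grad_inner_Basis[OF that] inner_add_left)
qed (auto intro!: continuous_intros harmonic_on_cont2[OF u] harmonic_on_cont2[OF v])

lemma harmonic_on_const: "open S \<Longrightarrow> harmonic_on S (\<lambda>x. c)"
  by (rule harmonic_onI[where U = "\<lambda>x. 0" and V = "\<lambda>b x. 0"]) (auto intro: GDERIV_const)

lemma harmonic_on_sum:
  assumes "open S" "\<And>i. i \<in> I \<Longrightarrow> harmonic_on S (u i)"
  shows "harmonic_on S (\<lambda>x. \<Sum>i\<in>I. u i x)"
  using assms(2)
  by (induction I rule: infinite_finite_induct) (auto intro!: harmonic_on_const harmonic_on_add assms(1))

section \<open>Mean values against a compactly supported kernel\<close>

text \<open>
  All averages are taken over this box. It contains the unit ball, which carries the kernels, with
  enough room to shift that ball by a unit vector, and integration over a box makes the rule for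
  differentiating under the integral sign applicable.
\<close>

abbreviation (input) test_box :: "'a::euclidean_space set" where
  "test_box \<equiv> cbox (- (2 *\<^sub>R One)) (2 *\<^sub>R One)"

lemma norm_le_cbox: "x \<in> test_box \<Longrightarrow> norm (x::'a::euclidean_space) \<le> 2 * DIM('a)"
proof -
  assume "x \<in> test_box"
  then have "\<bar>x \<bullet> b\<bar> \<le> 2" if "b \<in> Basis" for b using that by (auto simp: mem_box abs_le_iff)
  then have "(\<Sum>b\<in>Basis. \<bar>x \<bullet> b\<bar>) \<le> (\<Sum>b\<in>(Basis::'a set). 2)" by (rule sum_mono)
  with norm_le_l1[of x] show ?thesis by simp
qed

lemma integral_superset_support:
  fixes F :: "'a::euclidean_space \<Rightarrow> real"
  assumes "F integrable_on cbox a b" "\<And>x. x \<notin> cbox a b \<Longrightarrow> F x = 0" "cbox a b \<subseteq> T"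
  shows "integral T F = integral (cbox a b) F"
  using has_integral_on_superset[OF integrable_integral[OF assms(1)] assms(2,3)]
  by (simp add: integral_unique)

text \<open>
  The integral of a shifted copy of \<open>F\<close> does not depend on the shift, so its derivative with
  respect to the shift vanishes; differentiation under the integral sign identifies this derivative.
\<close>

lemma integral_partial_deriv_eq_0:
  fixes F G :: "'a::euclidean_space \<Rightarrow> real"
  assumes b: "b \<in> Basis"
    and F: "\<And>x t. ((\<lambda>t. F (x + t *\<^sub>R b)) has_real_derivative G (x + t *\<^sub>R b)) (at t)"
    and contF: "continuous_on UNIV F" and contG: "continuous_on UNIV G"
    and supp: "\<And>x. norm x > 1 \<Longrightarrow> F x = 0"
  shows "integral test_box G = 0"
proof -
  have F0: "F x = 0" if "x \<notin> cbox (- One) One" for x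
  proof -
    obtain c where "c \<in> Basis" "\<bar>x \<bullet> c\<bar> > 1" using \<open>x \<notin> _\<close> by (force simp: mem_box abs_le_iff not_le)
    with Basis_le_norm[of c x] show ?thesis by (intro supp) linarith
  qed
  have intF: "F integrable_on cbox p q" for p q
    by (intro integrable_continuous continuous_on_subset[OF contF]) simp
  have const: "integral test_box (\<lambda>z. F (z + t *\<^sub>R b)) = integral (cbox (- One) One) F" if "t \<in> {-1..1}" for t
  proof -
    have "integral test_box (\<lambda>z. F (z + t *\<^sub>R b)) =
        integral (cbox (- (2 *\<^sub>R One) + t *\<^sub>R b) (2 *\<^sub>R One + t *\<^sub>R b)) F"
      using integral_shift_cbox_plus[of "- (2 *\<^sub>R One)" "2 *\<^sub>R One" F "t *\<^sub>R b"]
      by (simp add: o_def add.commute)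
    also have "\<dots> = integral (cbox (- One) One) F"
    proof (rule integral_superset_support[OF intF F0])
      show "cbox (- One) One \<subseteq> cbox (- (2 *\<^sub>R One) + t *\<^sub>R b) (2 *\<^sub>R One + t *\<^sub>R b)"
        using that b by (auto simp: subset_box inner_add_left inner_Basis algebra_simps)
    qed
    finally show ?thesis .
  qed
  have "((\<lambda>t. integral test_box (\<lambda>z. F (z + t *\<^sub>R b))) has_field_derivative
      integral test_box (\<lambda>z. G (z + 0 *\<^sub>R b))) (at 0 within {-1..1})"
  proof (rule leibniz_rule_field_derivative)
    show "((\<lambda>t. F (z + t *\<^sub>R b)) has_field_derivative G (z + t *\<^sub>R b)) (at t within {-1..1})" for t z
      using F by (rule has_field_derivative_at_within)
    show "continuous_on ({-1..1} \<times> test_box) (\<lambda>(t, z). G (z + t *\<^sub>R b))"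
      unfolding split_beta by (intro continuous_on_compose2[OF contG] continuous_intros) auto
    show "(\<lambda>z. F (z + t *\<^sub>R b)) integrable_on test_box" for t
      by (intro integrable_continuous continuous_on_compose2[OF contF] continuous_intros) auto
  qed auto
  then have "((\<lambda>t::real. integral (cbox (- One) One) F) has_field_derivative
      integral test_box (\<lambda>z. G (z + 0 *\<^sub>R b))) (at 0 within {-1..1})"
    by (rule has_field_derivative_transform_within[OF _ zero_less_one]) (use const in auto)
  moreover have "((\<lambda>t::real. integral (cbox (- One) One) F) has_field_derivative 0) (at 0 within {-1..1})"
    by simp
  ultimately have "integral test_box (\<lambda>z. G (z + 0 *\<^sub>R b)) = 0"
    by (rule has_field_derivative_unique) (simp add: trivial_limit_within islimpt_Icc)
  then show ?thesis by simp
qed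

text \<open>
  Powers of this function are the kernels: the gradient of \<open>bump ^ (k + 1)\<close> is
  \<open>- 2 * (k + 1) * bump z ^ k *\<^sub>R z\<close>, so multiplying the kernel \<open>bump ^ k\<close> by a coordinate
  gives a derivative again, and the powers with exponent at least 2 are of class \<open>C\<^sup>1\<close> across
  the unit sphere.
\<close>

definition bump :: "'a::euclidean_space \<Rightarrow> real" where
  "bump z = max 0 (1 - (norm z)\<^sup>2)"

lemma bump_nonneg: "0 \<le> bump z" by (simp add: bump_def)
lemma bump_eq_0: "norm z \<ge> 1 \<Longrightarrow> bump z = 0" by (simp add: bump_def)
lemma continuous_on_bump [continuous_intros]: "continuous_on S f \<Longrightarrow> continuous_on S (\<lambda>x. bump (f x))"
  unfolding bump_def by (intro continuous_intros)

lemma max0_power_deriv: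
  assumes "k \<ge> 2"
  shows "((\<lambda>s::real. max 0 s ^ k) has_real_derivative real k * max 0 s ^ (k - 1)) (at s)"
proof (cases s "0::real" rule: linorder_cases)
  case less
  have "((\<lambda>s::real. 0) has_real_derivative 0) (at s)" by simp
  then have "((\<lambda>s::real. max 0 s ^ k) has_real_derivative 0) (at s)"
    by (rule has_field_derivative_transform_within_open[where S = "{..<0}"])
      (use less assms in \<open>auto simp: max_def power_0_left\<close>)
  then show ?thesis using less assms by (simp add: max_def power_0_left)
next
  case greater
  have "((\<lambda>s::real. s ^ k) has_real_derivative real k * s ^ (k - 1)) (at s)"
    by (auto intro!: derivative_eq_intros)
  then have "((\<lambda>s::real. max 0 s ^ k) has_real_derivative real k * s ^ (k - 1)) (at s)"
    by (rule has_field_derivative_transform_within_open[where S = "{0<..}"])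
      (use greater in \<open>auto simp: max_def\<close>)
  then show ?thesis using greater by (simp add: max_def)
next
  case equal
  obtain j where j: "k = Suc (Suc j)" using assms by (metis One_nat_def Suc_1 Suc_le_D Suc_le_mono)
  have "((\<lambda>s::real. max 0 s ^ k) has_real_derivative 0) (at 0)"
    unfolding has_field_derivative_iff
  proof (rule Lim_null_comparison)
    show "\<forall>\<^sub>F y in at 0. norm ((max 0 y ^ k - max 0 0 ^ k) / (y - 0)) \<le> \<bar>y\<bar> ^ Suc j"
    proof (rule always_eventually, rule allI)
      fix y :: real
      have "0 \<le> \<bar>y\<bar> ^ Suc j" by simp
      then show "norm ((max 0 y ^ k - max 0 0 ^ k) / (y - 0)) \<le> \<bar>y\<bar> ^ Suc j"
        by (cases "0 \<le> y") (auto simp: j max_def abs_mult simp del: power_Suc, simp)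
    qed
    have "((\<lambda>y::real. \<bar>y\<bar> ^ Suc j) \<longlongrightarrow> \<bar>0\<bar> ^ Suc j) (at 0)" by (intro tendsto_intros)
    then show "((\<lambda>y::real. \<bar>y\<bar> ^ Suc j) \<longlongrightarrow> 0) (at 0)" by simp
  qed
  then show ?thesis using equal j by simp
qed

lemma GDERIV_bump_power:
  assumes "k \<ge> 2"
  shows "GDERIV (\<lambda>z. bump z ^ k) z :> (- 2 * real k * bump z ^ (k - 1)) *\<^sub>R z"
proof -
  have "((\<lambda>z::'a. 1 - z \<bullet> z) has_derivative (\<lambda>h. - 2 * (h \<bullet> z))) (at z)"
    by (auto intro!: derivative_eq_intros simp: inner_commute)
  from has_derivative_compose[OF this max0_power_deriv[OF assms, unfolded has_field_derivative_def]]
  show ?thesis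
    by (simp add: gderiv_def bump_def power2_norm_eq_inner mult_ac)
qed

lemma GDERIV_affine:
  fixes w :: "'a::real_inner \<Rightarrow> real"
  assumes "GDERIV w (y + d *\<^sub>R z) :> D"
  shows "GDERIV (\<lambda>z. w (y + d *\<^sub>R z)) z :> d *\<^sub>R D"
proof -
  have "((\<lambda>z. y + d *\<^sub>R z) has_derivative (\<lambda>h. d *\<^sub>R h)) (at z)"
    by (auto intro!: derivative_eq_intros)
  from has_derivative_compose[OF this assms[unfolded gderiv_def]]
  show ?thesis by (simp add: gderiv_def)
qed

lemma GDERIV_cont_on:
  assumes "\<And>x. x \<in> S \<Longrightarrow> GDERIV w x :> W x"
  shows "continuous_on S w"
  using assms unfolding gderiv_def
  by (meson continuous_at_imp_continuous_on has_derivative_continuous)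

text \<open>
  The factor \<open>f (y + d *\<^sub>R z)\<close> is controlled only for \<open>z\<close> near the unit ball. Elsewhere the
  kernel vanishes, and the two open sets \<open>norm z > 1\<close> and \<open>y + d *\<^sub>R z \<in> S\<close> cover the space.
\<close>

lemma continuous_on_bump_mult:
  fixes f :: "'a::euclidean_space \<Rightarrow> 'b::real_normed_vector"
  assumes f: "continuous_on S f" and S: "open S"
    and yd: "\<And>z. norm z \<le> 1 \<Longrightarrow> y + d *\<^sub>R z \<in> S" and k: "k \<ge> 1"
  shows "continuous_on UNIV (\<lambda>z. bump z ^ k *\<^sub>R f (y + d *\<^sub>R z))"
proof -
  let ?A = "{z. norm z > 1}" and ?B = "(\<lambda>z. y + d *\<^sub>R z) -` S"
  have A: "open ?A" by (intro open_Collect_less continuous_intros)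
  have B: "open ?B" by (intro open_vimage S continuous_intros)
  have "continuous_on ?A (\<lambda>z. bump z ^ k *\<^sub>R f (y + d *\<^sub>R z))"
    using k by (subst continuous_on_cong[OF refl, of _ _ "\<lambda>z. 0"]) (auto simp: bump_eq_0 power_0_left)
  moreover have "continuous_on ?B (\<lambda>z. bump z ^ k *\<^sub>R f (y + d *\<^sub>R z))"
    by (intro continuous_intros continuous_on_compose2[OF f]) auto
  ultimately have "continuous_on (?A \<union> ?B) (\<lambda>z. bump z ^ k *\<^sub>R f (y + d *\<^sub>R z))"
    by (intro continuous_on_open_Un A B)
  moreover have "?A \<union> ?B = UNIV" using yd by (auto simp: not_less)
  ultimately show ?thesis by simp
qed

text \<open>
  Integration by parts: the integrand of the difference of the two sides is the derivative in
  direction \<open>b\<close> of the compactly supported function \<open>bump z ^ k * w (y + d *\<^sub>R z)\<close>.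
\<close>

lemma bump_parts:
  fixes w :: "'a::euclidean_space \<Rightarrow> real"
  assumes S: "open S" and w: "\<And>x. x \<in> S \<Longrightarrow> GDERIV w x :> W x" and W: "continuous_on S W"
    and yd: "\<And>z. norm z \<le> 1 \<Longrightarrow> y + d *\<^sub>R z \<in> S" and k: "k \<ge> 2" and b: "b \<in> Basis"
  shows "d * integral test_box (\<lambda>z. bump z ^ k * (W (y + d *\<^sub>R z) \<bullet> b)) =
         2 * real k * integral test_box (\<lambda>z. bump z ^ (k - 1) * (z \<bullet> b) * w (y + d *\<^sub>R z))"
proof -
  have k1: "k \<ge> 1" "k - 1 \<ge> 1" using k by auto
  have wc: "continuous_on S w" by (rule GDERIV_cont_on) (rule w)
  define F where "F = (\<lambda>z. bump z ^ k * w (y + d *\<^sub>R z))"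
  define G where "G = (\<lambda>z. d * (bump z ^ k * (W (y + d *\<^sub>R z) \<bullet> b)) -
          2 * real k * (bump z ^ (k - 1) * (z \<bullet> b) * w (y + d *\<^sub>R z)))"
  have c1: "continuous_on UNIV (\<lambda>z. bump z ^ k * (W (y + d *\<^sub>R z) \<bullet> b))"
    using continuous_on_bump_mult[of S "\<lambda>x. W x \<bullet> b", OF _ S yd k1(1)] W
    by (simp add: continuous_intros)
  have c2: "continuous_on UNIV (\<lambda>z. bump z ^ (k - 1) * (z \<bullet> b) * w (y + d *\<^sub>R z))"
  proof -
    have "continuous_on UNIV (\<lambda>z. (z \<bullet> b) *\<^sub>R (bump z ^ (k - 1) *\<^sub>R w (y + d *\<^sub>R z)))"
      by (intro continuous_on_scaleR continuous_on_bump_mult[OF wc S yd k1(2)] continuous_intros)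
    then show ?thesis by (simp add: mult_ac)
  qed
  have FG: "GDERIV F z :> bump z ^ k *\<^sub>R (d *\<^sub>R W (y + d *\<^sub>R z)) +
      w (y + d *\<^sub>R z) *\<^sub>R ((- 2 * real k * bump z ^ (k - 1)) *\<^sub>R z)" for z
  proof (cases "norm z > 1")
    case True
    have "GDERIV F z :> 0"
      by (rule GDERIV_cong_open[OF GDERIV_const[of 0], of "{z. norm z > 1}"])
        (use True k in \<open>auto simp: F_def bump_eq_0 power_0_left intro!: open_Collect_less continuous_intros\<close>)
    then show ?thesis using True k by (simp add: bump_eq_0 power_0_left)
  next
    case False
    then have "y + d *\<^sub>R z \<in> S" using yd by auto
    from GDERIV_mult[OF GDERIV_bump_power[OF k, of z] GDERIV_affine[OF w[OF this]]]
    show ?thesis by (simp add: F_def)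
  qed
  have "integral test_box G = 0"
  proof (rule integral_partial_deriv_eq_0[OF b, of F])
    show "((\<lambda>t. F (x + t *\<^sub>R b)) has_real_derivative G (x + t *\<^sub>R b)) (at t)" for x t
      by (rule DERIV_cong, rule GDERIV_line, rule FG)
        (simp add: G_def inner_add_left algebra_simps)
    show "continuous_on UNIV F"
      using continuous_on_bump_mult[OF wc S yd k1(1)] by (simp add: F_def)
    show "continuous_on UNIV G" unfolding G_def
      by (intro continuous_intros c1 c2)
    show "F x = 0" if "norm x > 1" for x using that k by (simp add: F_def bump_eq_0 power_0_left)
  qed
  moreover have "integral test_box G = d * integral test_box (\<lambda>z. bump z ^ k * (W (y + d *\<^sub>R z) \<bullet> b)) -
         2 * real k * integral test_box (\<lambda>z. bump z ^ (k - 1) * (z \<bullet> b) * w (y + d *\<^sub>R z))"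
  proof -
    have "(\<lambda>z. d * (bump z ^ k * (W (y + d *\<^sub>R z) \<bullet> b))) integrable_on test_box"
      "(\<lambda>z. 2 * real k * (bump z ^ (k - 1) * (z \<bullet> b) * w (y + d *\<^sub>R z))) integrable_on test_box"
      by (intro integrable_continuous continuous_on_mult[OF continuous_on_const]
          continuous_on_subset[OF c1] continuous_on_subset[OF c2] subset_UNIV)+
    then show ?thesis unfolding G_def by (subst integral_diff) auto
  qed
  ultimately show ?thesis by simp
qed

lemma cbox_shift_in:
  fixes y z :: "'a::euclidean_space" and d t :: real
  assumes "cball y (2 * real DIM('a) * d) \<subseteq> S" "z \<in> test_box" "0 \<le> t" "t \<le> d"
  shows "y + t *\<^sub>R z \<in> S"
proof -
  have "norm (t *\<^sub>R z) \<le> d * (2 * DIM('a))"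
    using assms norm_le_cbox[OF assms(2)] by (auto intro!: mult_mono)
  then show ?thesis using assms(1) by (auto simp: subset_iff dist_norm mult_ac)
qed

lemma unit_ball_cbox: "norm z \<le> 1 \<Longrightarrow> (z::'a::euclidean_space) \<in> test_box"
  using Basis_le_norm[of _ z] by (force simp: mem_box abs_le_iff)

text \<open>
  Let \<open>A t\<close> be the average of \<open>u (y + t *\<^sub>R z)\<close> against the kernel \<open>bump z ^ 2\<close>. Its derivative
  is the average of \<open>\<nabla>u (y + t *\<^sub>R z) \<bullet> z\<close>. Since \<open>bump z ^ 2 *\<^sub>R z\<close> is a multiple of the gradient
  of \<open>bump ^ 3\<close>, an integration by parts moves the derivative onto \<open>\<nabla>u\<close> and produces
  the Laplacian of \<open>u\<close>. Hence \<open>A\<close> is constant, and \<open>A 0\<close> is the value at the centre.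
\<close>

lemma harmonic_mean_value:
  fixes u :: "'a::euclidean_space \<Rightarrow> real" and d :: real
  assumes u: "harmonic_on S u" and d: "d \<ge> 0" and S: "cball y (2 * real DIM('a) * d) \<subseteq> S"
  shows "integral test_box (\<lambda>z. bump z ^ 2 * u (y + d *\<^sub>R z)) = u y * integral test_box (\<lambda>z::'a. bump z ^ 2)"
proof -
  note inS = cbox_shift_in[OF S]
  define A where "A = (\<lambda>t. integral test_box (\<lambda>z. bump z ^ 2 * u (y + t *\<^sub>R z)))"
  have cont: "continuous_on (cbox a b) (\<lambda>z. f z * g (y + t *\<^sub>R z))"
    if "continuous_on (cbox a b) f" "continuous_on S g" "cbox a b \<subseteq> test_box" "t \<in> {0..d}"
    for t and a b :: 'a and f g :: "'a \<Rightarrow> real"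
    by (intro continuous_intros that continuous_on_compose2[OF that(2)]) (use that inS in auto)
  have pc: "continuous_on S (partial_deriv b u)" if "b \<in> Basis" for b
    using GDERIV_cont_on harmonic_on_GDERIV2[OF u _ that] by blast
  have der: "(A has_field_derivative 0) (at t within {0..d})" if t: "t \<in> {0..d}" for t
  proof -
    have "(A has_field_derivative integral test_box (\<lambda>z. bump z ^ 2 * (grad u (y + t *\<^sub>R z) \<bullet> z)))
        (at t within {0..d})"
      unfolding A_def
    proof (rule leibniz_rule_field_derivative[where f = "\<lambda>t z. bump z ^ 2 * u (y + t *\<^sub>R z)" and fx = "\<lambda>t z. bump z ^ 2 * (grad u (y + t *\<^sub>R z) \<bullet> z)"])
      show "((\<lambda>t. bump z ^ 2 * u (y + t *\<^sub>R z)) has_field_derivative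
          bump z ^ 2 * (grad u (y + t *\<^sub>R z) \<bullet> z)) (at t within {0..d})" if "t \<in> {0..d}" "z \<in> test_box" for t z
        by (intro DERIV_cmult GDERIV_line harmonic_on_GDERIV[OF u]) (use that inS in auto)
      show "(\<lambda>z. bump z ^ 2 * u (y + t *\<^sub>R z)) integrable_on test_box" if "t \<in> {0..d}" for t
        by (intro integrable_continuous cont harmonic_on_cont[OF u] continuous_intros) (use that in auto)
      show "continuous_on ({0..d} \<times> test_box) (\<lambda>(t, z). bump z ^ 2 * (grad u (y + t *\<^sub>R z) \<bullet> z))"
        unfolding split_beta
        by (intro continuous_intros continuous_on_compose2[OF harmonic_on_cont1[OF u]]) (use inS in auto)
    qed (use t in auto)
    moreover have "integral test_box (\<lambda>z. bump z ^ 2 * (grad u (y + t *\<^sub>R z) \<bullet> z)) = 0"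
    proof -
      have ct: "continuous_on test_box (\<lambda>z. g (y + t *\<^sub>R z))" if "continuous_on S g"
        for g :: "'a \<Rightarrow> 'b::real_normed_vector"
        by (intro continuous_intros continuous_on_compose2[OF that]) (use t inS in auto)
      have "6 * integral test_box (\<lambda>z. bump z ^ 2 * (grad u (y + t *\<^sub>R z) \<bullet> z)) =
         6 * integral test_box (\<lambda>z. \<Sum>b\<in>Basis. bump z ^ 2 * (z \<bullet> b) * partial_deriv b u (y + t *\<^sub>R z))"
        by (simp add: grad_def inner_sum_left sum_distrib_left) (simp add: inner_commute mult_ac)
      also have "\<dots> = (\<Sum>b\<in>Basis. 6 * integral test_box (\<lambda>z. bump z ^ 2 * (z \<bullet> b) * partial_deriv b u (y + t *\<^sub>R z)))"
        by (subst integral_sum)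
          (auto simp: sum_distrib_left intro!: integrable_continuous continuous_on_mult
            continuous_on_power continuous_on_bump continuous_on_inner continuous_on_const continuous_on_id ct pc)
      also have "\<dots> = (\<Sum>b\<in>Basis. t * integral test_box (\<lambda>z. bump z ^ 3 * (grad (partial_deriv b u) (y + t *\<^sub>R z) \<bullet> b)))"
        using bump_parts[OF harmonic_on_open[OF u] harmonic_on_GDERIV2[OF u] harmonic_on_cont2[OF u], where k = 3 and y = y and d = t]
          inS[OF unit_ball_cbox] t by (intro sum.cong) auto
      also have "\<dots> = t * integral test_box (\<lambda>z. \<Sum>b\<in>Basis. bump z ^ 3 * (grad (partial_deriv b u) (y + t *\<^sub>R z) \<bullet> b))"
        by (subst integral_sum)
          (use t in \<open>auto simp: sum_distrib_left intro!: integrable_continuous continuous_on_mult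
            continuous_on_power continuous_on_bump continuous_on_inner continuous_on_const ct harmonic_on_cont2[OF u]\<close>)
      also have "integral test_box (\<lambda>z. \<Sum>b\<in>Basis. bump z ^ 3 * (grad (partial_deriv b u) (y + t *\<^sub>R z) \<bullet> b)) = integral test_box (\<lambda>z::'a. 0)"
        by (intro integral_cong) (use t inS in \<open>auto simp: sum_distrib_left[symmetric] harmonic_on_trace[OF u]\<close>)
      finally show ?thesis by simp
    qed
    ultimately show ?thesis by simp
  qed
  obtain c where "\<And>t. t \<in> {0..d} \<Longrightarrow> A t = c"
    using has_field_derivative_zero_constant[OF convex_closed_interval der] by blast
  from this[of d] this[of 0] have "A d = A 0" using d by simp
  then show ?thesis by (simp add: A_def mult.commute[of "u y"])
qed

text \<open>
  Differentiation under the integral sign in the base point. The derivative is a bounded linear map,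
  represented through its gradient vector so that the integral of the derivatives is again a
  gradient vector.
\<close>

lemma GDERIV_average:
  fixes w \<kappa> :: "'a::euclidean_space \<Rightarrow> real"
  assumes w: "\<And>x. x \<in> S \<Longrightarrow> GDERIV w x :> W x" and W: "continuous_on S W"
    and T: "open T" and TS: "\<And>x z. x \<in> T \<Longrightarrow> z \<in> test_box \<Longrightarrow> x + d *\<^sub>R z \<in> S"
    and \<kappa>: "continuous_on test_box \<kappa>"
  shows "x \<in> T \<Longrightarrow> GDERIV (\<lambda>x. integral test_box (\<lambda>z. \<kappa> z * w (x + d *\<^sub>R z))) x :>
           integral test_box (\<lambda>z. \<kappa> z *\<^sub>R W (x + d *\<^sub>R z))"
    and "continuous_on T (\<lambda>x. integral test_box (\<lambda>z. \<kappa> z *\<^sub>R W (x + d *\<^sub>R z)))"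
proof -
  have wc: "continuous_on S w" by (rule GDERIV_cont_on) (rule w)
  have c: "continuous_on (T \<times> test_box) (\<lambda>(x, z). \<kappa> z *\<^sub>R W (x + d *\<^sub>R z))"
    unfolding split_beta
    by (intro continuous_intros continuous_on_compose2[OF \<kappa>] continuous_on_compose2[OF W]) (use TS in auto)
  then show "continuous_on T (\<lambda>x. integral test_box (\<lambda>z. \<kappa> z *\<^sub>R W (x + d *\<^sub>R z)))"
    by (rule integral_continuous_on_param)
  assume x: "x \<in> T"
  then obtain e where e: "e > 0" "ball x e \<subseteq> T" using T openE by blast
  let ?f = "\<lambda>x z. blinfun_inner_left (\<kappa> z *\<^sub>R W (x + d *\<^sub>R z))"
  have "((\<lambda>x. integral test_box (\<lambda>z. \<kappa> z * w (x + d *\<^sub>R z))) has_derivative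
      blinfun_apply (integral test_box (?f x))) (at x within ball x e)"
  proof (rule leibniz_rule)
    fix x' z :: 'a assume *: "x' \<in> ball x e" "z \<in> test_box"
    then have "x' + d *\<^sub>R z \<in> S" using TS e by auto
    then have "((\<lambda>x. w (x + d *\<^sub>R z)) has_derivative (\<lambda>h. h \<bullet> W (x' + d *\<^sub>R z))) (at x')"
      by (intro has_derivative_compose[of "\<lambda>x. x + d *\<^sub>R z" "\<lambda>h. h" x' UNIV, OF _ w[unfolded gderiv_def]])
        (auto intro!: derivative_eq_intros)
    then have "((\<lambda>x. \<kappa> z * w (x + d *\<^sub>R z)) has_derivative (\<lambda>h. \<kappa> z * (h \<bullet> W (x' + d *\<^sub>R z)))) (at x')"
      by (rule has_derivative_mult_right)
    then show "((\<lambda>x. \<kappa> z * w (x + d *\<^sub>R z)) has_derivative blinfun_apply (?f x' z)) (at x' within ball x e)"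
      by (simp add: has_derivative_at_withinI)
  next
    fix x' assume "x' \<in> ball x e"
    then show "(\<lambda>z. \<kappa> z * w (x' + d *\<^sub>R z)) integrable_on test_box"
      by (intro integrable_continuous continuous_intros \<kappa> continuous_on_compose2[OF wc]) (use TS e in auto)
  next
    show "continuous_on (ball x e \<times> test_box) (\<lambda>(x, z). ?f x z)"
      using bounded_linear.continuous_on[OF bounded_linear_blinfun_inner_left continuous_on_subset[OF c]] e
      by (simp add: split_beta Sigma_mono)
  qed (use e in auto)
  moreover have "integral test_box (?f x) = blinfun_inner_left (integral test_box (\<lambda>z. \<kappa> z *\<^sub>R W (x + d *\<^sub>R z)))"
  proof -
    have "(\<lambda>z. \<kappa> z *\<^sub>R W (x + d *\<^sub>R z)) integrable_on test_box"
      by (intro integrable_continuous continuous_intros \<kappa> continuous_on_compose2[OF W]) (use TS x in auto)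
    from integral_linear[OF this bounded_linear_blinfun_inner_left] show ?thesis by (simp add: o_def)
  qed
  ultimately show "GDERIV (\<lambda>x. integral test_box (\<lambda>z. \<kappa> z * w (x + d *\<^sub>R z))) x :>
           integral test_box (\<lambda>z. \<kappa> z *\<^sub>R W (x + d *\<^sub>R z))"
    using e by (simp add: gderiv_def at_within_open[of x "ball x e"] fun_eq_iff)
qed

text \<open>
  An average of translates of a harmonic function is harmonic, because the Laplacian may be taken
  inside the integral.
\<close>

lemma harmonic_average:
  fixes u \<kappa> :: "'a::euclidean_space \<Rightarrow> real" and d :: real
  assumes u: "harmonic_on S u"
    and T: "open T" and TS: "\<And>x z. x \<in> T \<Longrightarrow> z \<in> test_box \<Longrightarrow> x + d *\<^sub>R z \<in> S"
    and \<kappa>: "continuous_on test_box \<kappa>"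
  shows "harmonic_on T (\<lambda>x. integral test_box (\<lambda>z. \<kappa> z * u (x + d *\<^sub>R z)))"
proof (rule harmonic_onI[where U = "\<lambda>x. integral test_box (\<lambda>z. \<kappa> z *\<^sub>R grad u (x + d *\<^sub>R z))"
      and V = "\<lambda>b x. integral test_box (\<lambda>z. \<kappa> z *\<^sub>R grad (partial_deriv b u) (x + d *\<^sub>R z))"])
  show "open T" by fact
  have int: "(\<lambda>z. \<kappa> z *\<^sub>R g (x + d *\<^sub>R z)) integrable_on test_box" if "continuous_on S g" "x \<in> T"
    for g :: "'a \<Rightarrow> 'a" and x
    by (intro integrable_continuous continuous_intros \<kappa> continuous_on_compose2[OF that(1)]) (use TS that in auto)
  have comp: "integral test_box (\<lambda>z. \<kappa> z *\<^sub>R g (x + d *\<^sub>R z)) \<bullet> b = integral test_box (\<lambda>z. \<kappa> z * (g (x + d *\<^sub>R z) \<bullet> b))"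
    if "continuous_on S g" "x \<in> T" for g :: "'a \<Rightarrow> 'a" and x b
    using integral_linear[OF int[OF that] bounded_linear_inner_left[of b]] by (simp add: o_def)
  show "GDERIV (\<lambda>x. integral test_box (\<lambda>z. \<kappa> z * u (x + d *\<^sub>R z))) x :>
      integral test_box (\<lambda>z. \<kappa> z *\<^sub>R grad u (x + d *\<^sub>R z))" if "x \<in> T" for x
    by (rule GDERIV_average(1)[OF harmonic_on_GDERIV[OF u] harmonic_on_cont1[OF u] T TS \<kappa> that])
  fix b :: 'a assume b: "b \<in> Basis"
  note avg = GDERIV_average[where S = S and T = T, OF harmonic_on_GDERIV2[OF u _ b] harmonic_on_cont2[OF u b] T TS \<kappa>]
  show "continuous_on T (\<lambda>x. integral test_box (\<lambda>z. \<kappa> z *\<^sub>R grad (partial_deriv b u) (x + d *\<^sub>R z)))"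
    by (rule avg(2))
  show "GDERIV (\<lambda>x. integral test_box (\<lambda>z. \<kappa> z *\<^sub>R grad u (x + d *\<^sub>R z)) \<bullet> b) x :>
      integral test_box (\<lambda>z. \<kappa> z *\<^sub>R grad (partial_deriv b u) (x + d *\<^sub>R z))" if "x \<in> T" for x
  proof (rule GDERIV_cong_open[OF _ T that])
    show "GDERIV (\<lambda>x. integral test_box (\<lambda>z. \<kappa> z * partial_deriv b u (x + d *\<^sub>R z))) x :>
        integral test_box (\<lambda>z. \<kappa> z *\<^sub>R grad (partial_deriv b u) (x + d *\<^sub>R z))"
      by (rule avg(1)) (use that in auto)
    show "integral test_box (\<lambda>z. \<kappa> z * partial_deriv b u (y + d *\<^sub>R z)) =
        integral test_box (\<lambda>z. \<kappa> z *\<^sub>R grad u (y + d *\<^sub>R z)) \<bullet> b" if "y \<in> T" for y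
      unfolding comp[OF harmonic_on_cont1[OF u] that] by (simp only: grad_inner_Basis[OF b])
  qed
next
  fix x assume x: "x \<in> T"
  have int: "(\<lambda>z. \<kappa> z *\<^sub>R g (x + d *\<^sub>R z)) integrable_on test_box" if "continuous_on S g"
    for g :: "'a \<Rightarrow> 'a"
    by (intro integrable_continuous continuous_intros \<kappa> continuous_on_compose2[OF that(1)]) (use TS x in auto)
  have int': "(\<lambda>z. \<kappa> z * (g (x + d *\<^sub>R z) \<bullet> b)) integrable_on test_box" if "continuous_on S g"
    for g :: "'a \<Rightarrow> 'a" and b
    using integrable_linear[OF int[OF that] bounded_linear_inner_left[of b]] by (simp add: o_def)
  have "(\<Sum>b\<in>Basis. integral test_box (\<lambda>z. \<kappa> z *\<^sub>R grad (partial_deriv b u) (x + d *\<^sub>R z)) \<bullet> b) =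
      (\<Sum>b\<in>Basis. integral test_box (\<lambda>z. \<kappa> z * (grad (partial_deriv b u) (x + d *\<^sub>R z) \<bullet> b)))"
    using integral_linear[OF int[OF harmonic_on_cont2[OF u]] bounded_linear_inner_left]
    by (intro sum.cong) (auto simp: o_def)
  also have "\<dots> = integral test_box (\<lambda>z. \<Sum>b\<in>Basis. \<kappa> z * (grad (partial_deriv b u) (x + d *\<^sub>R z) \<bullet> b))"
    by (subst integral_sum) (auto intro!: int' harmonic_on_cont2[OF u])
  also have "\<dots> = integral test_box (\<lambda>z::'a. 0)"
    using harmonic_on_trace[OF u TS[OF x]] by (intro integral_cong) (auto simp: sum_distrib_left[symmetric])
  finally show "(\<Sum>b\<in>Basis. integral test_box (\<lambda>z. \<kappa> z *\<^sub>R grad (partial_deriv b u) (x + d *\<^sub>R z)) \<bullet> b) = 0"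
    by simp
qed

lemma integral_bump_pos: "integral test_box (\<lambda>z::'a::euclidean_space. bump z ^ 2) > 0"
proof -
  have c: "continuous_on test_box (\<lambda>z::'a. bump z ^ 2)" by (intro continuous_intros)
  have "integral test_box (\<lambda>z::'a. bump z ^ 2) \<noteq> 0"
  proof
    assume "integral test_box (\<lambda>z::'a. bump z ^ 2) = 0"
    then have "((\<lambda>z::'a. bump z ^ 2) has_integral 0) test_box"
      using integrable_integral[OF integrable_continuous[OF c]] by simp
    then have "bump (0::'a) ^ 2 = 0"
      by (rule has_integral_0_cbox_imp_0[OF c, rotated]) (auto simp: mem_box box_ne_empty)
    then show False by (simp add: bump_def)
  qed
  moreover have "integral test_box (\<lambda>z::'a. bump z ^ 2) \<ge> 0"
    by (intro integral_nonneg integrable_continuous c) auto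
  ultimately show ?thesis by linarith
qed

text \<open>
  Differentiating the mean value property in the base point expresses \<open>\<partial>\<^sub>b u\<close> as an average of
  \<open>\<partial>\<^sub>b u\<close>, and an integration by parts turns it into an average of \<open>u\<close> itself with a fixed
  continuous kernel. All further regularity comes from this formula.
\<close>

lemma partial_deriv_average:
  fixes u :: "'a::euclidean_space \<Rightarrow> real" and d :: real
  assumes u: "harmonic_on S u" and d: "d > 0" and b: "b \<in> Basis"
    and T: "open T" and TS: "\<And>x. x \<in> T \<Longrightarrow> cball x (2 * real DIM('a) * d) \<subseteq> S" and x: "x \<in> T"
  shows "partial_deriv b u x = 4 / (d * integral test_box (\<lambda>z::'a. bump z ^ 2)) *
           integral test_box (\<lambda>z. (bump z * (z \<bullet> b)) * u (x + d *\<^sub>R z))"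
proof -
  let ?c = "integral test_box (\<lambda>z::'a. bump z ^ 2)"
  have TS': "x + d *\<^sub>R z \<in> S" if "x \<in> T" "z \<in> test_box" for x z
    using cbox_shift_in[OF TS[OF that(1)] that(2)] d by auto
  have xS: "x \<in> S" using TS[OF x] d by auto
  have cb: "continuous_on test_box (\<lambda>z::'a. bump z ^ 2)" by (intro continuous_intros)
  have int: "(\<lambda>z. bump z ^ 2 *\<^sub>R grad u (x + d *\<^sub>R z)) integrable_on test_box"
    by (intro integrable_continuous continuous_intros continuous_on_compose2[OF harmonic_on_cont1[OF u]])
      (use TS' x in auto)
  have 1: "GDERIV (\<lambda>x. integral test_box (\<lambda>z. bump z ^ 2 * u (x + d *\<^sub>R z))) x :>
      integral test_box (\<lambda>z. bump z ^ 2 *\<^sub>R grad u (x + d *\<^sub>R z))"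
    by (rule GDERIV_average(1)[OF harmonic_on_GDERIV[OF u] harmonic_on_cont1[OF u] T TS' cb x])
  have 2: "GDERIV (\<lambda>x. integral test_box (\<lambda>z. bump z ^ 2 * u (x + d *\<^sub>R z))) x :> ?c *\<^sub>R grad u x"
  proof (rule GDERIV_cong_open[OF _ T x])
    show "GDERIV (\<lambda>x. ?c * u x) x :> ?c *\<^sub>R grad u x"
      using GDERIV_mult[OF GDERIV_const[of ?c] harmonic_on_GDERIV[OF u xS]] by simp
    show "?c * u y = integral test_box (\<lambda>z. bump z ^ 2 * u (y + d *\<^sub>R z))" if "y \<in> T" for y
      using harmonic_mean_value[OF u _ TS[OF that]] d by simp
  qed
  have "?c *\<^sub>R grad u x = integral test_box (\<lambda>z. bump z ^ 2 *\<^sub>R grad u (x + d *\<^sub>R z))"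
    using trans[OF grad_eq[OF 2, symmetric] grad_eq[OF 1]] .
  from arg_cong[OF this, of "\<lambda>v. v \<bullet> b"]
  have "?c * partial_deriv b u x = integral test_box (\<lambda>z. bump z ^ 2 *\<^sub>R grad u (x + d *\<^sub>R z)) \<bullet> b"
    by (simp only: grad_inner_Basis[OF b] inner_scaleR_left)
  also have "\<dots> = integral test_box (\<lambda>z. bump z ^ 2 * (grad u (x + d *\<^sub>R z) \<bullet> b))"
    using integral_linear[OF int bounded_linear_inner_left[of b]] by (simp add: o_def)
  finally have eq: "?c * partial_deriv b u x = integral test_box (\<lambda>z. bump z ^ 2 * (grad u (x + d *\<^sub>R z) \<bullet> b))" .
  have "d * (?c * partial_deriv b u x) = 4 * integral test_box (\<lambda>z. bump z * (z \<bullet> b) * u (x + d *\<^sub>R z))"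
    unfolding eq
    using bump_parts[OF harmonic_on_open[OF u] harmonic_on_GDERIV[OF u] harmonic_on_cont1[OF u],
        where k = 2 and y = x and d = d, OF _ TS'[OF x unit_ball_cbox] _ b] by simp
  then show ?thesis using d integral_bump_pos[where 'a='a] by (simp add: field_simps)
qed

lemma cball_neighbourhood:
  fixes S :: "'a::euclidean_space set"
  assumes "open S" "cball y r \<subseteq> S" "0 \<le> r"
  obtains T where "open T" "y \<in> T" "\<And>x. x \<in> T \<Longrightarrow> cball x r \<subseteq> S"
proof -
  obtain e where e: "e > 0" "(\<Union>x\<in>cball y r. ball x e) \<subseteq> S"
    using compact_subset_open_imp_ball_epsilon_subset[OF compact_cball assms(1,2)] by blast
  show ?thesis
  proof (rule that[of "ball y e"])
    show "cball x r \<subseteq> S" if "x \<in> ball y e" for x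
    proof
      fix z assume "z \<in> cball x r"
      then have "z - x + y \<in> cball y r" "z \<in> ball (z - x + y) e"
        using that by (auto simp: dist_norm norm_minus_commute)
      then show "z \<in> S" using e by blast
    qed
  qed (use e in auto)
qed

text \<open>
  Harmonic functions, assumed to be of class \<open>C\<^sup>2\<close> only, are infinitely often differentiable, with
  harmonic derivatives: near each point, \<open>\<partial>\<^sub>b u\<close> is an average of translates of \<open>u\<close>.
\<close>

theorem harmonic_partial_deriv:
  fixes u :: "'a::euclidean_space \<Rightarrow> real"
  assumes u: "harmonic_on S u" and b: "b \<in> Basis"
  shows "harmonic_on S (partial_deriv b u)"
proof (rule harmonic_on_locally)
  fix y assume "y \<in> S"
  then obtain r where r: "r > 0" "cball y r \<subseteq> S"
    using harmonic_on_open[OF u] open_contains_cball by blast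
  define d where "d = r / (2 * real DIM('a))"
  have d: "d > 0" "2 * real DIM('a) * d = r" using r by (auto simp: d_def)
  obtain T where T: "open T" "y \<in> T" "\<And>x. x \<in> T \<Longrightarrow> cball x (2 * real DIM('a) * d) \<subseteq> S"
    using cball_neighbourhood[OF harmonic_on_open[OF u] r(2)] r d by auto
  define \<kappa> where "\<kappa> = (\<lambda>z::'a. 4 / (d * integral test_box (\<lambda>z::'a. bump z ^ 2)) * (bump z * (z \<bullet> b)))"
  have 1: "harmonic_on T (\<lambda>x. integral test_box (\<lambda>z. \<kappa> z * u (x + d *\<^sub>R z)))"
  proof (rule harmonic_average[OF u T(1)])
    show "x + d *\<^sub>R z \<in> S" if "x \<in> T" "z \<in> test_box" for x z
      using cbox_shift_in[OF T(3)[OF that(1)] that(2)] d by simp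
    show "continuous_on test_box \<kappa>" unfolding \<kappa>_def by (intro continuous_intros)
  qed
  have 2: "partial_deriv b u x = integral test_box (\<lambda>z. \<kappa> z * u (x + d *\<^sub>R z))" if "x \<in> T" for x
  proof -
    have "partial_deriv b u x = 4 / (d * integral test_box (\<lambda>z::'a. bump z ^ 2)) *
           integral test_box (\<lambda>z. (bump z * (z \<bullet> b)) * u (x + d *\<^sub>R z))"
      by (rule partial_deriv_average[OF u d(1) b T(1,3) that])
    then show ?thesis unfolding \<kappa>_def by (simp only: mult.assoc integral_mult_right)
  qed
  have "harmonic_on T (partial_deriv b u)"
    by (rule harmonic_on_cong[OF 1 2])
  moreover have "x \<in> S" if "x \<in> T" for x using T(3)[OF that] d(1) by auto
  ultimately show "\<exists>T. y \<in> T \<and> T \<subseteq> S \<and> harmonic_on T (partial_deriv b u)" using T by blast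
qed

text \<open>
  The gradient estimate, with a constant depending on the dimension only. The prefactor in
  \<open>partial_deriv_average\<close> is inversely proportional to the scale \<open>d\<close>, and the scale may be a fixed fraction of the
  radius of a ball in the domain.
\<close>

theorem partial_deriv_estimate:
  obtains A where "A > 0"
    "\<And>S u y r M b. \<lbrakk>harmonic_on S u; cball (y::'a::euclidean_space) r \<subseteq> S; r > 0; b \<in> Basis;
       \<And>x. x \<in> cball y r \<Longrightarrow> \<bar>u x\<bar> \<le> M\<rbrakk> \<Longrightarrow> \<bar>partial_deriv b u y\<bar> \<le> A / r * M"
proof -
  let ?c = "integral test_box (\<lambda>z::'a. bump z ^ 2)"
  define C where "C = integral test_box (\<lambda>z::'a. bump z * norm z)"
  define A where "A = 8 * real DIM('a) / ?c * (C + 1)"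
  have C0: "C \<ge> 0" unfolding C_def
    by (intro integral_nonneg integrable_continuous continuous_intros) (auto simp: bump_nonneg)
  have c: "?c > 0" by (rule integral_bump_pos)
  show ?thesis
  proof (rule that[of A])
    show "A > 0" using C0 c by (simp add: A_def)
    fix S and u :: "'a \<Rightarrow> real" and y r M b
    assume u: "harmonic_on S u" and r: "cball y r \<subseteq> S" "r > 0" and b: "b \<in> (Basis::'a set)"
      and M: "\<And>x. x \<in> cball y r \<Longrightarrow> \<bar>u x\<bar> \<le> M"
    have M0: "M \<ge> 0" using M[of y] r by auto
    define d where "d = r / (2 * real DIM('a))"
    have d: "d > 0" "2 * real DIM('a) * d = r" using r by (auto simp: d_def)
    obtain T where T: "open T" "y \<in> T" "\<And>x. x \<in> T \<Longrightarrow> cball x (2 * real DIM('a) * d) \<subseteq> S"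
      using cball_neighbourhood[OF harmonic_on_open[OF u] r(1)] r d by auto
    have sh: "y + d *\<^sub>R z \<in> cball y r" if "z \<in> test_box" for z
      using cbox_shift_in[of y d "cball y r" z d] d that by auto
    have "norm (integral test_box (\<lambda>z. (bump z * (z \<bullet> b)) * u (y + d *\<^sub>R z))) \<le> integral test_box (\<lambda>z::'a. bump z * norm z * M)"
    proof (rule integral_norm_bound_integral)
      show "(\<lambda>z. (bump z * (z \<bullet> b)) * u (y + d *\<^sub>R z)) integrable_on test_box"
        by (intro integrable_continuous continuous_intros continuous_on_compose2[OF harmonic_on_cont[OF u]])
          (use sh r in blast)
      show "(\<lambda>z::'a. bump z * norm z * M) integrable_on test_box"
        by (intro integrable_continuous continuous_intros)
      show "norm ((bump z * (z \<bullet> b)) * u (y + d *\<^sub>R z)) \<le> bump z * norm z * M" if "z \<in> test_box" for z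
        unfolding norm_mult
        using M[OF sh[OF that]] Basis_le_norm[OF b, of z] M0
        by (intro mult_mono mult_nonneg_nonneg) (auto simp: bump_nonneg)
    qed
    also have "\<dots> = C * M" by (simp add: C_def)
    also have "\<dots> \<le> (C + 1) * M" using M0 by (intro mult_right_mono) auto
    finally have 1: "\<bar>integral test_box (\<lambda>z. (bump z * (z \<bullet> b)) * u (y + d *\<^sub>R z))\<bar> \<le> (C + 1) * M" by simp
    have "partial_deriv b u y = 4 / (d * ?c) * integral test_box (\<lambda>z. (bump z * (z \<bullet> b)) * u (y + d *\<^sub>R z))"
      by (rule partial_deriv_average[OF u d(1) b T(1,3,2)])
    then have "\<bar>partial_deriv b u y\<bar> = 4 / (d * ?c) * \<bar>integral test_box (\<lambda>z. (bump z * (z \<bullet> b)) * u (y + d *\<^sub>R z))\<bar>"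
      using d c by (simp add: abs_mult)
    also have "\<dots> \<le> 4 / (d * ?c) * ((C + 1) * M)"
      using 1 d c by (intro mult_left_mono) auto
    also have "\<dots> = A / r * M" using d c r by (simp add: A_def d_def field_simps)
    finally show "\<bar>partial_deriv b u y\<bar> \<le> A / r * M" .
  qed
qed

section \<open>The Euler operator and analyticity along rays\<close>

lemma GDERIV_sum:
  assumes "\<And>i. i \<in> I \<Longrightarrow> GDERIV (f i) x :> D i"
  shows "GDERIV (\<lambda>x. \<Sum>i\<in>I. f i x) x :> (\<Sum>i\<in>I. D i)"
  using assms by (induction I rule: infinite_finite_induct) (auto intro: GDERIV_const GDERIV_add)

lemma GDERIV_inner_const: "GDERIV (\<lambda>x. x \<bullet> b) x :> b"
  unfolding gderiv_def by (auto intro!: derivative_eq_intros)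

lemma inner_grad_eq: "grad u x \<bullet> v = (\<Sum>b\<in>Basis. (v \<bullet> b) * partial_deriv b u x)"
  unfolding grad_def inner_sum_left inner_scaleR_left by (simp add: inner_commute mult.commute)

lemma GDERIV_euler:
  assumes u: "harmonic_on S u" and x: "x \<in> S"
  shows "GDERIV (\<lambda>x. grad u x \<bullet> x) x :> (\<Sum>b\<in>Basis. (x \<bullet> b) *\<^sub>R grad (partial_deriv b u) x) + grad u x"
proof -
  have "GDERIV (\<lambda>x. \<Sum>b\<in>Basis. (x \<bullet> b) * partial_deriv b u x) x :>
      (\<Sum>b\<in>Basis. (x \<bullet> b) *\<^sub>R grad (partial_deriv b u) x + partial_deriv b u x *\<^sub>R b)"
    by (intro GDERIV_sum GDERIV_mult GDERIV_inner_const harmonic_on_GDERIV2[OF u x])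
  then show ?thesis by (simp add: inner_grad_eq sum.distrib) (simp add: grad_def)
qed

text \<open>
  The commutator of the Laplacian with the Euler operator \<open>x \<bullet> \<nabla>\<close> is twice the Laplacian.
\<close>

lemma harmonic_euler:
  fixes u :: "'a::euclidean_space \<Rightarrow> real"
  assumes u: "harmonic_on S u"
  shows "harmonic_on S (\<lambda>x. grad u x \<bullet> x)"
proof (rule harmonic_onI)
  note u1 = harmonic_partial_deriv[OF u]
  note u2 = harmonic_partial_deriv[OF u1]
  let ?U = "\<lambda>x. (\<Sum>b\<in>Basis. (x \<bullet> b) *\<^sub>R grad (partial_deriv b u) x) + grad u x"
  let ?V = "\<lambda>c x. (\<Sum>b\<in>Basis. (x \<bullet> b) *\<^sub>R grad (partial_deriv c (partial_deriv b u)) x +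
       partial_deriv c (partial_deriv b u) x *\<^sub>R b) + grad (partial_deriv c u) x"
  show "open S" by (rule harmonic_on_open[OF u])
  show "GDERIV (\<lambda>x. grad u x \<bullet> x) x :> ?U x" if "x \<in> S" for x
    by (rule GDERIV_euler[OF u that])
  show "GDERIV (\<lambda>x. ?U x \<bullet> c) x :> ?V c x" if x: "x \<in> S" and c: "c \<in> Basis" for x c
  proof -
    have "GDERIV (\<lambda>x. (\<Sum>b\<in>Basis. (x \<bullet> b) * partial_deriv c (partial_deriv b u) x) + partial_deriv c u x) x :> ?V c x"
      by (intro GDERIV_add GDERIV_sum GDERIV_mult GDERIV_inner_const
          harmonic_on_GDERIV2[OF u x c] harmonic_on_GDERIV2[OF u1 x c])
    then show ?thesis by (simp add: inner_add_left inner_sum_left grad_inner_Basis[OF c])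
  qed
  show "continuous_on S (?V c)" if c: "c \<in> Basis" for c
    by (intro continuous_intros harmonic_on_cont2[OF u c] harmonic_on_cont2[OF u1 c] harmonic_on_cont[OF u2] c)
  show "(\<Sum>c\<in>Basis. ?V c x \<bullet> c) = 0" if x: "x \<in> S" for x
  proof -
    have "(\<Sum>c\<in>Basis. \<Sum>b\<in>Basis. (x \<bullet> b) * (grad (partial_deriv c (partial_deriv b u)) x \<bullet> c)) =
        (\<Sum>b\<in>Basis. (x \<bullet> b) * (\<Sum>c\<in>Basis. grad (partial_deriv c (partial_deriv b u)) x \<bullet> c))"
      by (subst sum.swap) (simp add: sum_distrib_left)
    also have "\<dots> = 0" using harmonic_on_trace[OF u1 x] by simp
    finally have 1: "(\<Sum>c\<in>Basis. \<Sum>b\<in>Basis. (x \<bullet> b) * (grad (partial_deriv c (partial_deriv b u)) x \<bullet> c)) = 0" .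
    have "(\<Sum>c\<in>Basis. \<Sum>b\<in>Basis. partial_deriv c (partial_deriv b u) x * (b \<bullet> c)) =
        (\<Sum>c\<in>Basis. partial_deriv c (partial_deriv c u) x)"
      by (intro sum.cong refl) (simp add: inner_Basis if_distrib sum.delta cong: if_cong)
    also have "\<dots> = 0" using harmonic_on_trace[OF u x] by (simp add: grad_inner_Basis)
    finally have 2: "(\<Sum>c\<in>Basis. \<Sum>b\<in>Basis. partial_deriv c (partial_deriv b u) x * (b \<bullet> c)) = 0" .
    show ?thesis
      using 1 2 harmonic_on_trace[OF u x]
      by (simp add: inner_add_left inner_sum_left sum.distrib)
  qed
qed

text \<open>
  The logarithmic radial derivative, conjugated by the power \<open>norm x powr \<kappa>\<close>. In dimension \<open>N\<close> the
  shift \<open>\<kappa> = (N - 2) / 2\<close> removes the first-order radial term from the Laplacian, which becomes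
  \<open>norm x ^ 2 * \<Delta> = L ^ 2 - \<kappa> ^ 2 + \<Delta>\<^sub>S\<close> with \<open>L = shifted_euler \<kappa>\<close> and the Laplacian
  \<open>\<Delta>\<^sub>S\<close> of the sphere.
\<close>

definition shifted_euler :: "real \<Rightarrow> ('a::euclidean_space \<Rightarrow> real) \<Rightarrow> 'a \<Rightarrow> real" where
  "shifted_euler \<kappa> u x = grad u x \<bullet> x + \<kappa> * u x"

lemma harmonic_shifted_euler: "harmonic_on S u \<Longrightarrow> harmonic_on S (shifted_euler \<kappa> u)"
  unfolding shifted_euler_def[abs_def] by (intro harmonic_on_add harmonic_euler harmonic_on_scale)

lemma harmonic_shifted_euler_iter: "harmonic_on S u \<Longrightarrow> harmonic_on S ((shifted_euler \<kappa> ^^ k) u)"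
  by (induction k) (auto intro: harmonic_shifted_euler)

lemma shifted_euler_estimate:
  fixes R \<kappa> :: real
  assumes R: "R > 0"
  obtains C where "C > 0"
    "\<And>S u y r M. \<lbrakk>harmonic_on S u; cball (y::'a::euclidean_space) r \<subseteq> S; 0 < r; r \<le> R; norm y \<le> R;
       \<And>x. x \<in> cball y r \<Longrightarrow> \<bar>u x\<bar> \<le> M\<rbrakk> \<Longrightarrow> \<bar>shifted_euler \<kappa> u y\<bar> \<le> C / r * M"
proof -
  obtain A where A: "A > 0" "\<And>S u y r M b. \<lbrakk>harmonic_on S u; cball (y::'a) r \<subseteq> S; r > 0; b \<in> Basis;
       \<And>x. x \<in> cball y r \<Longrightarrow> \<bar>u x\<bar> \<le> M\<rbrakk> \<Longrightarrow> \<bar>partial_deriv b u y\<bar> \<le> A / r * M"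
    using partial_deriv_estimate[where 'a = 'a] by blast
  \<comment> \<open>the zeroth-order term \<open>\<kappa> * u\<close> is absorbed through \<open>1 \<le> R / r\<close>\<close>
  define C where "C = real DIM('a) * R * A + \<bar>\<kappa>\<bar> * R"
  show ?thesis
  proof (rule that[of C])
    show "C > 0" using R A(1) by (simp add: C_def add_pos_nonneg)
    fix S and u :: "'a \<Rightarrow> real" and y r M
    assume u: "harmonic_on S u" "cball y r \<subseteq> S" and r: "0 < r" "r \<le> R" and y: "norm y \<le> R"
      and M: "\<And>x. x \<in> cball y r \<Longrightarrow> \<bar>u x\<bar> \<le> M"
    have uy: "\<bar>u y\<bar> \<le> M" using M[of y] r by auto
    then have M0: "M \<ge> 0" by linarith
    have "\<bar>grad u y \<bullet> y\<bar> \<le> (\<Sum>b\<in>(Basis::'a set). R * (A / r * M))"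
      unfolding inner_grad_eq
    proof (rule order_trans[OF sum_abs], rule sum_mono)
      fix b :: 'a assume b: "b \<in> Basis"
      show "\<bar>(y \<bullet> b) * partial_deriv b u y\<bar> \<le> R * (A / r * M)"
        unfolding abs_mult using A(2)[OF u r(1) b M] Basis_le_norm[OF b, of y] y R
        by (intro mult_mono) auto
    qed
    moreover have "\<bar>\<kappa> * u y\<bar> \<le> \<bar>\<kappa>\<bar> * (R / r * M)"
    proof -
      have "1 * M \<le> R / r * M" using r M0 by (intro mult_right_mono) auto
      with uy show ?thesis unfolding abs_mult by (intro mult_left_mono) auto
    qed
    ultimately have "\<bar>shifted_euler \<kappa> u y\<bar> \<le> real DIM('a) * (R * (A / r * M)) + \<bar>\<kappa>\<bar> * (R / r * M)"
      unfolding shifted_euler_def sum_constant by linarith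
    also have "\<dots> = C / r * M" using r by (simp add: C_def field_simps)
    finally show "\<bar>shifted_euler \<kappa> u y\<bar> \<le> C / r * M" .
  qed
qed

lemma power_le_exp_fact: "real k ^ k \<le> exp 1 ^ k * fact k"
proof -
  have "(\<Sum>n\<in>{k}. real k ^ n /\<^sub>R fact n) \<le> (\<Sum>n. real k ^ n /\<^sub>R fact n)"
    by (rule sum_le_suminf[OF summable_exp_generic]) auto
  then have "real k ^ k / fact k \<le> exp (real k)" by (simp add: exp_def field_simps)
  also have "exp (real k) = exp 1 ^ k" by (simp add: exp_of_nat_mult[symmetric])
  finally show ?thesis by (simp add: field_simps)
qed

text \<open>
  Cauchy estimates. To bound \<open>L ^ k\<close> on the half ball, the gradient estimate is applied \<open>k\<close> times, each
  time shrinking the radius by \<open>r / (2 * k)\<close>. This costs the factor \<open>(2 * C * k / r) ^ k\<close>, and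
  \<open>k ^ k \<le> exp 1 ^ k * fact k\<close> turns it into a bound of analytic type.
\<close>

lemma shifted_euler_iter_estimate:
  fixes R \<kappa> :: real
  assumes R: "R > 0"
  obtains C where "C > 0"
    "\<And>S u y r M x k. \<lbrakk>harmonic_on S u; cball (y::'a::euclidean_space) r \<subseteq> S; cball y r \<subseteq> cball 0 R; 0 < r; r \<le> R;
       \<And>x. x \<in> cball y r \<Longrightarrow> \<bar>u x\<bar> \<le> M; x \<in> cball y (r / 2)\<rbrakk> \<Longrightarrow>
       \<bar>(shifted_euler \<kappa> ^^ k) u x\<bar> \<le> M * (C / r) ^ k * fact k"
proof -
  obtain C where C: "C > 0"
    "\<And>S u y r M. \<lbrakk>harmonic_on S u; cball (y::'a::euclidean_space) r \<subseteq> S; 0 < r; r \<le> R; norm y \<le> R;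
       \<And>x. x \<in> cball y r \<Longrightarrow> \<bar>u x\<bar> \<le> M\<rbrakk> \<Longrightarrow> \<bar>shifted_euler \<kappa> u y\<bar> \<le> C / r * M"
    using shifted_euler_estimate[OF R, of \<kappa>, where 'a = 'a] by blast
  show ?thesis
  proof (rule that[of "2 * C * exp 1"])
    show "2 * C * exp 1 > 0" using C by simp
    fix S and u :: "'a \<Rightarrow> real" and y r M x k
    assume u: "harmonic_on S u" and yS: "cball y r \<subseteq> S" "cball y r \<subseteq> cball 0 R" and r: "0 < r" "r \<le> R"
      and M: "\<And>x. x \<in> cball y r \<Longrightarrow> \<bar>u x\<bar> \<le> M" and x: "x \<in> cball y (r / 2)"
    have M0: "M \<ge> 0" using M[of y] r by auto
    show "\<bar>(shifted_euler \<kappa> ^^ k) u x\<bar> \<le> M * (2 * C * exp 1 / r) ^ k * fact k"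
    proof (cases "k = 0")
      case True then show ?thesis using M[of x] x r by auto
    next
      case False
      \<comment> \<open>\<open>k\<close> steps of this length lead from radius \<open>r\<close> to \<open>r / 2\<close>\<close>
      define s where "s = r / (2 * k)"
      have s: "s > 0" "s \<le> r" "real k * s = r / 2" using r False by (auto simp: s_def field_simps)
      have step: "\<bar>(shifted_euler \<kappa> ^^ j) u x\<bar> \<le> (C / s) ^ j * M"
        if "j \<le> k" "x \<in> cball y (r - j * s)" for j x
        using that
      proof (induction j arbitrary: x)
        case 0 then show ?case using M by simp
      next
        case (Suc j)
        have sub: "cball x s \<subseteq> cball y (r - j * s)"
        proof
          fix z assume "z \<in> cball x s"
          then show "z \<in> cball y (r - j * s)"
            using Suc.prems(2) dist_triangle[of y z x] by (simp add: algebra_simps)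
        qed
        have "cball y (r - j * s) \<subseteq> cball y r" using s by (intro subset_cball) simp
        then have sub': "cball x s \<subseteq> S" "x \<in> cball 0 R"
          using sub yS s(1) by (auto, metis centre_in_cball less_eq_real_def mem_cball_0 subsetD)
        have "\<bar>shifted_euler \<kappa> ((shifted_euler \<kappa> ^^ j) u) x\<bar> \<le> C / s * ((C / s) ^ j * M)"
          by (rule C(2)[OF harmonic_shifted_euler_iter[OF u] sub'(1) s(1)])
            (use s r sub' Suc sub in auto)
        then show ?case by (simp add: mult.assoc)
      qed
      have "r - real k * s = r / 2" using s by simp
      then have "\<bar>(shifted_euler \<kappa> ^^ k) u x\<bar> \<le> (C / s) ^ k * M"
        using step[of k x] x by (simp add: mult.commute)
      also have "(C / s) ^ k = (2 * C / r) ^ k * real k ^ k"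
        using r False by (simp add: s_def power_mult_distrib[symmetric] mult_ac)
      also have "\<dots> \<le> (2 * C / r) ^ k * (exp 1 ^ k * fact k)"
        using C r by (intro mult_left_mono power_le_exp_fact) auto
      finally show ?thesis using M0 by (simp add: power_mult_distrib power_divide mult_ac mult_right_mono)
    qed
  qed
qed

text \<open>
  The identity theorem for real-analytic functions on the line, with the derivatives given as a sequence
  and analyticity as the growth bound \<open>M * C ^ k * fact k\<close>: the set where all derivatives
  vanish is closed, and it is open by Taylor's theorem.
\<close>

lemma real_analytic_eq_0:
  fixes F :: "nat \<Rightarrow> real \<Rightarrow> real"
  assumes der: "\<And>k s. (F k has_real_derivative F (Suc k) s) (at s)"
    and bound: "\<And>s0. \<exists>M C d. d > 0 \<and> (\<forall>k s. \<bar>s - s0\<bar> < d \<longrightarrow> \<bar>F k s\<bar> \<le> M * C ^ k * fact k)"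
    and zero: "\<And>k. F k 0 = 0"
  shows "F 0 s = 0"
proof -
  define Z where "Z = {s. \<forall>k. F k s = 0}"
  have "closed Z"
  proof -
    have "continuous_on UNIV (F k)" for k
      using der by (intro DERIV_continuous_on) (auto intro: has_field_derivative_at_within)
    then have "closed (F k -` {0})" for k
      using continuous_on_closed_vimage[of UNIV "F k"] by simp
    moreover have "Z = (\<Inter>k. F k -` {0})" by (auto simp: Z_def)
    ultimately show ?thesis by auto
  qed
  moreover have "open Z"
    unfolding open_contains_ball
  proof
    fix s0 assume s0: "s0 \<in> Z"
    obtain M C d where d: "d > 0" and B: "\<And>k s. \<bar>s - s0\<bar> < d \<Longrightarrow> \<bar>F k s\<bar> \<le> M * C ^ k * fact k"
      using bound by blast
    \<comment> \<open>on this scale the Taylor remainders are dominated by a geometric series of ratio 1/2\<close>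
    define e where "e = min d (1 / (2 * (\<bar>C\<bar> + 1)))"
    have e: "e > 0" "e \<le> d" using d by (auto simp: e_def)
    have eC: "\<bar>C\<bar> * e \<le> 1 / 2"
    proof -
      have "\<bar>C\<bar> * e \<le> \<bar>C\<bar> * (1 / (2 * (\<bar>C\<bar> + 1)))" by (intro mult_left_mono) (auto simp: e_def)
      also have "\<dots> \<le> 1 / 2" by (simp add: field_simps)
      finally show ?thesis .
    qed
    have F0: "F 0 s = 0" if s: "\<bar>s - s0\<bar> < e" for s
    proof (cases "s = s0")
      case True then show ?thesis using s0 by (simp add: Z_def)
    next
      case False
      have *: "\<bar>F 0 s\<bar> \<le> \<bar>M\<bar> * (1 / 2) ^ n" if "n > 0" for n
      proof -
        have "\<exists>t. (if s < s0 then s < t \<and> t < s0 else s0 < t \<and> t < s) \<and>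
            F 0 s = (\<Sum>m<n. (F m s0 / fact m) * (s - s0) ^ m) + (F n t / fact n) * (s - s0) ^ n"
          by (rule Taylor[OF that refl, where a = "min s s0" and b = "max s s0"]) (use der False in auto)
        then obtain t where "if s < s0 then s < t \<and> t < s0 else s0 < t \<and> t < s"
            "F 0 s = (\<Sum>m<n. (F m s0 / fact m) * (s - s0) ^ m) + (F n t / fact n) * (s - s0) ^ n"
          by blast
        then have t: "\<bar>t - s0\<bar> < e" "F 0 s = (F n t / fact n) * (s - s0) ^ n"
          using s s0 by (auto simp: Z_def split: if_splits)
        have "\<bar>F 0 s\<bar> = \<bar>F n t\<bar> / fact n * \<bar>s - s0\<bar> ^ n"
          unfolding t(2) by (simp add: abs_mult power_abs)
        also have "\<dots> \<le> (\<bar>M\<bar> * \<bar>C\<bar> ^ n) * e ^ n"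
        proof (intro mult_mono power_mono)
          have "\<bar>F n t\<bar> \<le> M * C ^ n * fact n" using t e by (intro B) auto
          then have "\<bar>F n t\<bar> / fact n \<le> M * C ^ n" by (simp add: field_simps)
          also have "\<dots> \<le> \<bar>M * C ^ n\<bar>" by simp
          finally show "\<bar>F n t\<bar> / fact n \<le> \<bar>M\<bar> * \<bar>C\<bar> ^ n" by (simp add: abs_mult power_abs)
        qed (use s in auto)
        also have "\<dots> = \<bar>M\<bar> * (\<bar>C\<bar> * e) ^ n" by (simp add: power_mult_distrib)
        also have "\<dots> \<le> \<bar>M\<bar> * (1 / 2) ^ n" using eC e by (intro mult_left_mono power_mono) auto
        finally show ?thesis .
      qed
      have "(\<lambda>n. \<bar>M\<bar> * (1 / 2 :: real) ^ n) \<longlonglongrightarrow> \<bar>M\<bar> * 0"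
        by (intro tendsto_intros LIMSEQ_power_zero) auto
      then have "\<bar>F 0 s\<bar> \<le> \<bar>M\<bar> * 0"
        by (rule LIMSEQ_le_const) (use * in \<open>auto intro!: exI[of _ 1]\<close>)
      then show ?thesis by simp
    qed
    have "\<forall>s\<in>ball s0 e. F k s = 0" for k
    proof (induction k)
      case 0 then show ?case using F0 by (auto simp: dist_real_def abs_minus_commute)
    next
      case (Suc k)
      show ?case
      proof
        fix s assume s: "s \<in> ball s0 e"
        have "(F k has_real_derivative 0) (at s)"
          by (rule has_field_derivative_transform_within_open[where f = "\<lambda>_. 0" and S = "ball s0 e"])
            (use s Suc in auto)
        with der show "F (Suc k) s = 0" by (metis DERIV_unique)
      qed
    qed
    then show "\<exists>e>0. ball s0 e \<subseteq> Z"
      using e by (intro exI[of _ e]) (auto simp: Z_def)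
  qed
  moreover have "0 \<in> Z" using zero by (simp add: Z_def)
  ultimately have "Z = UNIV" using connected_clopen[of "UNIV :: real set"] by auto
  then show ?thesis by (auto simp: Z_def)
qed

section \<open>Odd reflection in the unit sphere\<close>

lemma GDERIV_tangential:
  fixes f :: "'a::euclidean_space \<Rightarrow> real"
  assumes f0: "\<And>y. y \<in> sphere 0 1 \<Longrightarrow> f y = 0" and x: "x \<in> sphere 0 1"
    and D: "GDERIV f x :> D" and v: "v \<bullet> x = 0"
  shows "D \<bullet> v = 0"
proof (cases "v = 0")
  case False
  define w where "w = v /\<^sub>R norm v"
  have w: "norm w = 1" "x \<bullet> w = 0" using False v by (auto simp: w_def inner_commute)
  define \<gamma> where "\<gamma> = (\<lambda>t. cos t *\<^sub>R x + sin t *\<^sub>R w)"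
  have "\<gamma> t \<in> sphere 0 1" for t
  proof -
    have "(norm (\<gamma> t))\<^sup>2 = (cos t)\<^sup>2 * (norm x)\<^sup>2 + (sin t)\<^sup>2 * (norm w)\<^sup>2"
      unfolding \<gamma>_def power2_norm_eq_inner using w(2)
      by (simp add: inner_add_left inner_add_right inner_commute power2_eq_square)
    then have "(norm (\<gamma> t))\<^sup>2 = 1\<^sup>2" using w x by simp
    then have "norm (\<gamma> t) = 1" by (subst (asm) power2_eq_iff_nonneg) auto
    then show ?thesis by simp
  qed
  then have 0: "(\<lambda>t. f (\<gamma> t)) = (\<lambda>t. 0)" using f0 by auto
  have "(\<gamma> has_derivative (\<lambda>t. t *\<^sub>R w)) (at 0)"
    unfolding \<gamma>_def by (auto intro!: derivative_eq_intros)
  moreover have "(f has_derivative (\<lambda>h. h \<bullet> D)) (at (\<gamma> 0))"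
    using D by (simp add: gderiv_def \<gamma>_def)
  ultimately have "((\<lambda>t. f (\<gamma> t)) has_derivative (\<lambda>t. (t *\<^sub>R w) \<bullet> D)) (at 0)"
    by (rule has_derivative_compose)
  then have "(\<lambda>t. (t *\<^sub>R w) \<bullet> D) = (\<lambda>t::real. 0)"
    unfolding 0 by (intro has_derivative_unique[OF _ has_derivative_const])
  then have "(1 *\<^sub>R w) \<bullet> D = 0" by (rule fun_cong)
  then show ?thesis using False by (simp add: w_def inner_commute)
qed simp

text \<open>
  On functions vanishing on the sphere, \<open>\<Delta>\<^sub>S\<close> gives zero there, so \<open>L ^ 2 u = 0\<close> on the sphere
  for harmonic \<open>u\<close>. Concretely, \<open>\<Delta>\<^sub>S\<close> is half the sum of the squares of the rotation fields
  \<open>x\<^sub>b \<partial>\<^sub>c - x\<^sub>c \<partial>\<^sub>b\<close>. Each field is tangential and therefore maps functions vanishing on the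
  sphere to such functions; summing the squares and using \<open>\<Delta>u = 0\<close> leaves
  \<open>D + (N - 1) * E = 0\<close>, where \<open>D\<close> is the second derivative of \<open>u\<close> in direction \<open>x\<close> and \<open>E\<close> is
  \<open>\<nabla>u \<bullet> x\<close>.
\<close>

lemma shifted_euler_twice_sphere:
  fixes u :: "'a::euclidean_space \<Rightarrow> real"
  assumes u: "harmonic_on S u" and S: "sphere 0 1 \<subseteq> S"
    and u0: "\<And>x. x \<in> sphere 0 1 \<Longrightarrow> u x = 0"
    and \<kappa>: "2 * \<kappa> = real DIM('a) - 2" and x: "x \<in> sphere 0 1"
  shows "shifted_euler \<kappa> (shifted_euler \<kappa> u) x = 0"
proof -
  have xS: "x \<in> S" using x S by auto
  define p where "p = (\<lambda>b. partial_deriv b u x)"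
  define H where "H = (\<lambda>b c. grad (partial_deriv b u) x \<bullet> c)"
  define E where "E = grad u x \<bullet> x"
  have E: "E = (\<Sum>b\<in>Basis. (x \<bullet> b) * p b)" by (simp add: E_def inner_grad_eq p_def)
  have xx: "(\<Sum>b\<in>Basis. (x \<bullet> b) * (x \<bullet> b)) = 1"
    using x euclidean_inner[of x x] by (simp add: norm_eq_1)
  have T0: "(y \<bullet> b) * partial_deriv c u y - (y \<bullet> c) * partial_deriv b u y = 0"
    if y: "y \<in> sphere 0 1" and bc: "b \<in> Basis" "c \<in> Basis" for y b c
  proof -
    have "grad u y \<bullet> ((y \<bullet> b) *\<^sub>R c - (y \<bullet> c) *\<^sub>R b) = 0"
      using y S by (intro GDERIV_tangential[OF u0 y harmonic_on_GDERIV[OF u]])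
        (auto simp: inner_diff_right inner_commute)
    then show ?thesis using bc by (simp add: inner_diff_right grad_inner_Basis)
  qed
  \<comment> \<open>the square of the rotation field in the \<open>b\<close>-\<open>c\<close> plane, written out\<close>
  have T1: "(x \<bullet> b) * (x \<bullet> b) * H c c - (x \<bullet> b) * (x \<bullet> c) * H c b
      - (x \<bullet> c) * (x \<bullet> b) * H b c + (x \<bullet> c) * (x \<bullet> c) * H b b
      + 2 * (if b = c then (x \<bullet> b) * p b else 0) - (x \<bullet> c) * p c - (x \<bullet> b) * p b = 0"
    if bc: "b \<in> Basis" "c \<in> Basis" for b c
  proof -
    have g: "GDERIV (\<lambda>y. (y \<bullet> b) * partial_deriv c u y - (y \<bullet> c) * partial_deriv b u y) x :>
       ((x \<bullet> b) *\<^sub>R grad (partial_deriv c u) x + p c *\<^sub>R b) - ((x \<bullet> c) *\<^sub>R grad (partial_deriv b u) x + p b *\<^sub>R c)"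
      unfolding p_def
      by (intro GDERIV_diff GDERIV_mult GDERIV_inner_const harmonic_on_GDERIV2[OF u xS] bc)
    have "(((x \<bullet> b) *\<^sub>R grad (partial_deriv c u) x + p c *\<^sub>R b) - ((x \<bullet> c) *\<^sub>R grad (partial_deriv b u) x + p b *\<^sub>R c))
        \<bullet> ((x \<bullet> b) *\<^sub>R c - (x \<bullet> c) *\<^sub>R b) = 0"
      by (rule GDERIV_tangential[OF T0[OF _ bc] x g]) (auto simp: inner_diff_right inner_commute)
    then show ?thesis using bc
      by (cases "b = c") (simp_all add: inner_diff_left inner_diff_right inner_add_left inner_Basis H_def algebra_simps)
  qed
  define D where "D = (\<Sum>b\<in>Basis. \<Sum>c\<in>Basis. (x \<bullet> b) * (x \<bullet> c) * H b c)"
  have tr: "(\<Sum>c\<in>Basis. H c c) = 0" using harmonic_on_trace[OF u xS] by (simp add: H_def)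
  have "0 = (\<Sum>b\<in>Basis. \<Sum>c\<in>Basis. (x \<bullet> b) * (x \<bullet> b) * H c c - (x \<bullet> b) * (x \<bullet> c) * H c b
      - (x \<bullet> c) * (x \<bullet> b) * H b c + (x \<bullet> c) * (x \<bullet> c) * H b b
      + 2 * (if b = c then (x \<bullet> b) * p b else 0) - (x \<bullet> c) * p c - (x \<bullet> b) * p b)"
    using T1 by simp
  also have "\<dots> = (\<Sum>b\<in>Basis. \<Sum>c\<in>Basis. (x \<bullet> b) * (x \<bullet> b) * H c c) - (\<Sum>b\<in>Basis. \<Sum>c\<in>Basis. (x \<bullet> b) * (x \<bullet> c) * H c b)
      - (\<Sum>b\<in>Basis. \<Sum>c\<in>Basis. (x \<bullet> c) * (x \<bullet> b) * H b c) + (\<Sum>b\<in>Basis. \<Sum>c\<in>Basis. (x \<bullet> c) * (x \<bullet> c) * H b b)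
      + (\<Sum>b\<in>Basis. \<Sum>c\<in>Basis. 2 * (if b = c then (x \<bullet> b) * p b else 0))
      - (\<Sum>b\<in>(Basis::'a set). \<Sum>c\<in>Basis. (x \<bullet> c) * p c) - (\<Sum>b\<in>Basis. \<Sum>c\<in>(Basis::'a set). (x \<bullet> b) * p b)"
    by (simp only: sum.distrib sum_subtractf)
  also have "(\<Sum>b\<in>Basis. \<Sum>c\<in>Basis. (x \<bullet> b) * (x \<bullet> b) * H c c) = 0"
    using tr by (simp add: sum_distrib_left[symmetric])
  also have "(\<Sum>b\<in>Basis. \<Sum>c\<in>Basis. (x \<bullet> b) * (x \<bullet> c) * H c b) = D"
    unfolding D_def by (subst sum.swap) (simp add: mult_ac)
  also have "(\<Sum>b\<in>Basis. \<Sum>c\<in>Basis. (x \<bullet> c) * (x \<bullet> b) * H b c) = D"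
    unfolding D_def by (simp add: mult_ac)
  also have "(\<Sum>b\<in>Basis. \<Sum>c\<in>Basis. (x \<bullet> c) * (x \<bullet> c) * H b b) = 0"
    using tr by (subst sum.swap) (simp add: sum_distrib_left[symmetric])
  also have "(\<Sum>b\<in>Basis. \<Sum>c\<in>Basis. 2 * (if b = c then (x \<bullet> b) * p b else 0)) = 2 * E"
    by (simp add: E sum_distrib_left[symmetric] sum.delta)
  also have "(\<Sum>b\<in>(Basis::'a set). \<Sum>c\<in>Basis. (x \<bullet> c) * p c) = DIM('a) * E" by (simp add: E)
  also have "(\<Sum>b\<in>Basis. \<Sum>c\<in>(Basis::'a set). (x \<bullet> b) * p b) = DIM('a) * E"
    by (simp add: E sum_distrib_left)
  finally have DE: "D + (real DIM('a) - 1) * E = 0" by (simp add: algebra_simps)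
  have "GDERIV (shifted_euler \<kappa> u) x :> ((\<Sum>b\<in>Basis. (x \<bullet> b) *\<^sub>R grad (partial_deriv b u) x) + grad u x) + \<kappa> *\<^sub>R grad u x"
    unfolding shifted_euler_def[abs_def]
    using GDERIV_add[OF GDERIV_euler[OF u xS] GDERIV_mult[OF GDERIV_const[of \<kappa>] harmonic_on_GDERIV[OF u xS]]]
    by simp
  from grad_eq[OF this] have "grad (shifted_euler \<kappa> u) x \<bullet> x = (\<Sum>b\<in>Basis. (x \<bullet> b) * (grad (partial_deriv b u) x \<bullet> x)) + E + \<kappa> * E"
    by (simp add: inner_add_left inner_sum_left E_def)
  also have "(\<Sum>b\<in>Basis. (x \<bullet> b) * (grad (partial_deriv b u) x \<bullet> x)) = D"
    unfolding D_def H_def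
    by (intro sum.cong refl) (subst euclidean_inner[of _ x], simp add: sum_distrib_left mult_ac)
  finally have "shifted_euler \<kappa> (shifted_euler \<kappa> u) x = D + E + 2 * \<kappa> * E"
    unfolding shifted_euler_def[of \<kappa> "shifted_euler \<kappa> u" x] shifted_euler_def[of \<kappa> u x]
    by (simp add: u0[OF x] E_def)
  also have "\<dots> = 0" unfolding \<kappa> using DE by (simp add: algebra_simps)
  finally show ?thesis .
qed

lemma shifted_euler_even_sphere:
  fixes u :: "'a::euclidean_space \<Rightarrow> real"
  assumes u: "harmonic_on S u" and S: "sphere 0 1 \<subseteq> S"
    and u0: "\<And>x. x \<in> sphere 0 1 \<Longrightarrow> u x = 0"
    and \<kappa>: "2 * \<kappa> = real DIM('a) - 2" and x: "x \<in> sphere 0 1" and k: "even k"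
  shows "(shifted_euler \<kappa> ^^ k) u x = 0"
proof -
  have "\<forall>x\<in>sphere 0 1. (shifted_euler \<kappa> ^^ (2 * j)) u x = 0" for j
  proof (induction j)
    case 0 then show ?case using u0 by simp
  next
    case (Suc j)
    then show ?case
      using shifted_euler_twice_sphere[OF harmonic_shifted_euler_iter[OF u, where k = "2 * j"] S _ \<kappa>] by simp
  qed
  then show ?thesis using k x by (metis evenE)
qed

lemma shifted_euler_ray_deriv:
  fixes u :: "'a::euclidean_space \<Rightarrow> real"
  assumes u: "harmonic_on S u" and S: "exp s *\<^sub>R w \<in> S"
  shows "((\<lambda>s. exp (\<kappa> * s) * u (exp s *\<^sub>R w)) has_real_derivative
           exp (\<kappa> * s) * shifted_euler \<kappa> u (exp s *\<^sub>R w)) (at s)"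
proof -
  have "((\<lambda>s. u (0 + s *\<^sub>R w)) has_real_derivative grad u (exp s *\<^sub>R w) \<bullet> w) (at (exp s))"
    by (rule GDERIV_line) (use harmonic_on_GDERIV[OF u S] in simp)
  then have "((\<lambda>s. u (0 + exp s *\<^sub>R w)) has_real_derivative grad u (exp s *\<^sub>R w) \<bullet> w * exp s) (at s)"
    by (rule DERIV_chain2) (rule DERIV_exp)
  then show ?thesis
    by (auto intro!: derivative_eq_intros simp: shifted_euler_def algebra_simps)
qed

text \<open>
  The reflection principle: \<open>u\<close> equals minus its Kelvin transform on every ray from the origin along which
  it is harmonic.
  In the variable \<open>s = ln t\<close> the function \<open>exp (\<kappa> * s) * u (exp s *\<^sub>R w)\<close> is real-analytic
  on the line with \<open>k\<close>-th derivative \<open>exp (\<kappa> * s) * (L ^ k) u (exp s *\<^sub>R w)\<close>. By iteration of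
  \<open>shifted_euler_twice_sphere\<close> its even derivatives vanish at \<open>s = 0\<close>, so it is odd.
\<close>

theorem harmonic_kelvin_odd:
  fixes u :: "'a::euclidean_space \<Rightarrow> real"
  assumes u: "harmonic_on S u" and S: "sphere 0 1 \<subseteq> S"
    and u0: "\<And>x. x \<in> sphere 0 1 \<Longrightarrow> u x = 0"
    and \<kappa>: "2 * \<kappa> = real DIM('a) - 2" and w: "w \<in> sphere 0 1"
    and ray: "\<And>t. t > 0 \<Longrightarrow> t *\<^sub>R w \<in> S"
  shows "exp (\<kappa> * s) * u (exp s *\<^sub>R w) = - (exp (- \<kappa> * s) * u (exp (- s) *\<^sub>R w))"
proof -
  define F where "F = (\<lambda>k s. exp (\<kappa> * s) * (shifted_euler \<kappa> ^^ k) u (exp s *\<^sub>R w))"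
  have F': "(F k has_real_derivative F (Suc k) s) (at s)" for k s
    unfolding F_def using shifted_euler_ray_deriv[OF harmonic_shifted_euler_iter[OF u], of s w] ray[of "exp s"]
    by simp
  have FB: "\<exists>M C d. d > 0 \<and> M \<ge> 0 \<and> C \<ge> 0 \<and> (\<forall>k s. \<bar>s - s0\<bar> < d \<longrightarrow> \<bar>F k s\<bar> \<le> M * C ^ k * fact k)" for s0
  proof -
    let ?y = "exp s0 *\<^sub>R w"
    obtain r where r: "r > 0" "cball ?y r \<subseteq> S"
      using ray[of "exp s0"] harmonic_on_open[OF u] open_contains_cball by (metis exp_gt_zero)
    define R where "R = exp s0 + r"
    have R: "R > 0" "r \<le> R" using r by (auto simp: R_def add_pos_pos)
    have sub: "cball ?y r \<subseteq> cball 0 R"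
    proof
      fix z assume "z \<in> cball ?y r"
      then have "norm (z - ?y) \<le> r" by (simp add: dist_norm norm_minus_commute)
      then show "z \<in> cball 0 R" using norm_triangle_ineq[of "z - ?y" ?y] w by (simp add: R_def)
    qed
    obtain C where C: "C > 0"
      "\<And>S u y r M x k. \<lbrakk>harmonic_on S u; cball (y::'a) r \<subseteq> S; cball y r \<subseteq> cball 0 R; 0 < r; r \<le> R;
       \<And>x. x \<in> cball y r \<Longrightarrow> \<bar>u x\<bar> \<le> M; x \<in> cball y (r / 2)\<rbrakk> \<Longrightarrow>
       \<bar>(shifted_euler \<kappa> ^^ k) u x\<bar> \<le> M * (C / r) ^ k * fact k"
      using shifted_euler_iter_estimate[OF R(1), of \<kappa>, where 'a='a] by blast
    have "compact (u ` cball ?y r)"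
      by (intro compact_continuous_image compact_cball continuous_on_subset[OF harmonic_on_cont[OF u] r(2)])
    then obtain M where M: "\<And>x. x \<in> cball ?y r \<Longrightarrow> \<bar>u x\<bar> \<le> M"
      using compact_imp_bounded bounded_iff by (metis imageI real_norm_def)
    have M0: "M \<ge> 0" using M[of ?y] r by auto
    have "continuous (at s0) (\<lambda>s. exp s *\<^sub>R w)" by (intro continuous_intros)
    then obtain d0 where d0: "d0 > 0" "\<And>s. \<bar>s - s0\<bar> < d0 \<Longrightarrow> dist (exp s *\<^sub>R w) ?y < r / 2"
      unfolding continuous_at_eps_delta dist_real_def using r(1) by (metis half_gt_zero)
    define d where "d = min d0 1"
    define K where "K = exp (\<bar>\<kappa>\<bar> * (\<bar>s0\<bar> + 1))"
    have "\<bar>F k s\<bar> \<le> (K * M) * (C / r) ^ k * fact k" if s: "\<bar>s - s0\<bar> < d" for k s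
    proof -
      have "\<bar>s\<bar> \<le> \<bar>s0\<bar> + 1" using s by (auto simp: d_def)
      then have "\<bar>\<kappa> * s\<bar> \<le> \<bar>\<kappa>\<bar> * (\<bar>s0\<bar> + 1)" unfolding abs_mult by (intro mult_left_mono) auto
      then have "exp (\<kappa> * s) \<le> K" unfolding K_def exp_le_cancel_iff by linarith
      moreover have "\<bar>(shifted_euler \<kappa> ^^ k) u (exp s *\<^sub>R w)\<bar> \<le> M * (C / r) ^ k * fact k"
        using d0(2)[of s] s by (intro C(2)[OF u r(2) sub r(1) R(2) M]) (auto simp: d_def dist_commute)
      ultimately have "\<bar>F k s\<bar> \<le> K * (M * (C / r) ^ k * fact k)"
        unfolding F_def abs_mult by (intro mult_mono) (auto simp: K_def)
      then show ?thesis by (simp add: mult.assoc)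
    qed
    moreover have "d > 0" "K * M \<ge> 0" "C / r \<ge> 0" using d0 C r M0 by (auto simp: d_def K_def)
    ultimately show ?thesis by blast
  qed
  \<comment> \<open>twice the even part of the function along the ray, with its derivatives\<close>
  define G where "G = (\<lambda>k s. F k s + (- 1) ^ k * F k (- s))"
  have "G 0 s = 0"
  proof (rule real_analytic_eq_0[where F = G])
    show "(G k has_real_derivative G (Suc k) s) (at s)" for k s
    proof -
      have "((\<lambda>s. F k (- s)) has_real_derivative - F (Suc k) (- s)) (at s)"
        using DERIV_chain2[where f = "F k" and g = uminus, OF F' DERIV_minus[OF DERIV_ident]] by simp
      then show ?thesis unfolding G_def by (auto intro!: derivative_eq_intros F')
    qed
    show "\<exists>M C d. d > 0 \<and> (\<forall>k s. \<bar>s - s0\<bar> < d \<longrightarrow> \<bar>G k s\<bar> \<le> M * C ^ k * fact k)" for s0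
    proof -
      obtain M1 C1 d1 where 1: "d1 > 0" "M1 \<ge> 0" "C1 \<ge> 0"
          "\<And>k s. \<bar>s - s0\<bar> < d1 \<Longrightarrow> \<bar>F k s\<bar> \<le> M1 * C1 ^ k * fact k" using FB by blast
      obtain M2 C2 d2 where 2: "d2 > 0" "M2 \<ge> 0" "C2 \<ge> 0"
          "\<And>k s. \<bar>s - - s0\<bar> < d2 \<Longrightarrow> \<bar>F k s\<bar> \<le> M2 * C2 ^ k * fact k" using FB[of "- s0"] by blast
      have "\<bar>G k s\<bar> \<le> (M1 + M2) * max C1 C2 ^ k * fact k" if s: "\<bar>s - s0\<bar> < min d1 d2" for k s
      proof -
        have "\<bar>G k s\<bar> \<le> \<bar>F k s\<bar> + \<bar>F k (- s)\<bar>"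
          unfolding G_def by (rule order_trans[OF abs_triangle_ineq]) (simp add: abs_mult power_abs)
        also have "\<dots> \<le> M1 * C1 ^ k * fact k + M2 * C2 ^ k * fact k"
          using s by (intro add_mono 1(4) 2(4)) auto
        also have "\<dots> \<le> M1 * max C1 C2 ^ k * fact k + M2 * max C1 C2 ^ k * fact k"
          using 1 2 by (intro add_mono mult_right_mono mult_left_mono power_mono) auto
        finally show ?thesis by (simp add: algebra_simps)
      qed
      then show ?thesis using 1(1) 2(1) by (intro exI[of _ "M1 + M2"] exI[of _ "max C1 C2"] exI[of _ "min d1 d2"]) auto
    qed
    show "G k 0 = 0" for k
    proof (cases "even k")
      case True
      then show ?thesis using shifted_euler_even_sphere[OF u S u0 \<kappa> w True] by (simp add: G_def F_def)
    qed (simp add: G_def)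
  qed
  then show ?thesis by (simp add: G_def F_def)
qed

section \<open>The Newtonian kernel and the maximum principle\<close>

lemma GDERIV_sq_powr:
  fixes x p :: "'a::real_inner"
  assumes "x \<noteq> p"
  shows "GDERIV (\<lambda>x. ((x - p) \<bullet> (x - p)) powr a) x :>
           (2 * a * ((x - p) \<bullet> (x - p)) powr (a - 1)) *\<^sub>R (x - p)"
proof -
  have "GDERIV (\<lambda>x. (x - p) \<bullet> (x - p)) x :> 2 *\<^sub>R (x - p)"
    unfolding gderiv_def by (auto intro!: derivative_eq_intros simp: inner_commute)
  then have "GDERIV (\<lambda>x. ((x - p) \<bullet> (x - p)) powr a) x :> (a * ((x - p) \<bullet> (x - p)) powr (a - 1)) *\<^sub>R (2 *\<^sub>R (x - p))"
    by (rule GDERIV_DERIV_compose) (use assms in \<open>auto intro!: has_real_derivative_powr\<close>)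
  then show ?thesis by (simp add: mult_ac)
qed

lemma norm_powr_sq: "(norm x) powr (2 * a) = (x \<bullet> x) powr a"
  by (cases "x = 0") (simp_all add: powr_powr[symmetric] power2_norm_eq_inner[symmetric] powr_numeral)

lemma harmonic_newton:
  fixes p :: "'a::euclidean_space"
  assumes \<kappa>: "2 * \<kappa> = real DIM('a) - 2"
  shows "harmonic_on (- {p}) (\<lambda>x. ((x - p) \<bullet> (x - p)) powr (- \<kappa>))"
proof (rule harmonic_onI)
  let ?q = "\<lambda>x. (x - p) \<bullet> (x - p)"
  let ?U = "\<lambda>x. (2 * (- \<kappa>) * ?q x powr (- \<kappa> - 1)) *\<^sub>R (x - p)"
  let ?V = "\<lambda>b x. (2 * (- \<kappa>)) *\<^sub>R (?q x powr (- \<kappa> - 1) *\<^sub>R b +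
      ((x - p) \<bullet> b) *\<^sub>R ((2 * (- \<kappa> - 1) * ?q x powr (- \<kappa> - 1 - 1)) *\<^sub>R (x - p)))"
  show "open (- {p})" by auto
  show "GDERIV (\<lambda>x. ?q x powr (- \<kappa>)) x :> ?U x" if "x \<in> - {p}" for x
    using that by (intro GDERIV_sq_powr) auto
  show "GDERIV (\<lambda>x. ?U x \<bullet> b) x :> ?V b x" if x: "x \<in> - {p}" for x b
  proof -
    have 1: "GDERIV (\<lambda>x. (x - p) \<bullet> b) x :> b"
      unfolding gderiv_def by (auto intro!: derivative_eq_intros)
    have "GDERIV (\<lambda>x. ?q x powr (- \<kappa> - 1) * ((x - p) \<bullet> b)) x :>
        ?q x powr (- \<kappa> - 1) *\<^sub>R b + ((x - p) \<bullet> b) *\<^sub>R ((2 * (- \<kappa> - 1) * ?q x powr (- \<kappa> - 1 - 1)) *\<^sub>R (x - p))"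
      using x by (intro GDERIV_mult 1 GDERIV_sq_powr) auto
    from GDERIV_mult[OF GDERIV_const[of "2 * (- \<kappa>)"] this] show ?thesis
      by (simp add: mult_ac)
  qed
  show "continuous_on (- {p}) (?V b)" for b by (intro continuous_intros) auto
  show "(\<Sum>b\<in>Basis. ?V b x \<bullet> b) = 0" if x: "x \<in> - {p}" for x
  proof -
    have q: "?q x > 0" using x by simp
    have "(\<Sum>b\<in>Basis. ?V b x \<bullet> b) = (\<Sum>b\<in>Basis. 2 * (- \<kappa>) * (?q x powr (- \<kappa> - 1) +
        2 * (- \<kappa> - 1) * ?q x powr (- \<kappa> - 1 - 1) * (((x - p) \<bullet> b) * ((x - p) \<bullet> b))))"
      by (intro sum.cong refl) (simp add: inner_add_left mult_ac)
    also have "\<dots> = 2 * (- \<kappa>) * (real DIM('a) * ?q x powr (- \<kappa> - 1) +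
        2 * (- \<kappa> - 1) * ?q x powr (- \<kappa> - 1 - 1) * ?q x)"
      by (simp only: sum.distrib sum_distrib_left[symmetric] euclidean_inner[symmetric] sum_constant)
    also have "\<dots> = 2 * (- \<kappa>) * (real DIM('a) * ?q x powr (- \<kappa> - 1) +
        2 * (- \<kappa> - 1) * (?q x powr (- \<kappa> - 1 - 1) * ?q x))" by (simp only: mult.assoc)
    also have "?q x powr (- \<kappa> - 1 - 1) * ?q x = ?q x powr (- \<kappa> - 1)"
      using powr_add[of "?q x" "- \<kappa> - 1 - 1" 1]
      by (simp only: diff_add_cancel powr_one[OF less_imp_le[OF q]])
    also have "2 * (- \<kappa>) * (real DIM('a) * ?q x powr (- \<kappa> - 1) + 2 * (- \<kappa> - 1) * ?q x powr (- \<kappa> - 1)) = 0"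
    proof -
      have "real DIM('a) = 2 * \<kappa> + 2" using \<kappa> by simp
      then show ?thesis by (simp add: algebra_simps)
    qed
    finally show ?thesis by (simp add: mult.assoc)
  qed
qed

lemma second_deriv_local_max:
  fixes f f' :: "real \<Rightarrow> real"
  assumes d: "d > 0" and f: "\<And>t. \<bar>t\<bar> < d \<Longrightarrow> (f has_real_derivative f' t) (at t)"
    and f': "(f' has_real_derivative D) (at 0)" and max: "\<And>t. \<bar>t\<bar> < d \<Longrightarrow> f t \<le> f 0"
  shows "D \<le> 0"
proof (rule ccontr)
  assume "\<not> D \<le> 0"
  then have D: "D > 0" by simp
  have "f' 0 = 0" by (rule DERIV_local_max[OF f d]) (use d max in auto)
  with DERIV_pos_inc_right[OF f' D] obtain e where e: "e > 0" "\<And>h. 0 < h \<Longrightarrow> h < e \<Longrightarrow> f' h > 0" by auto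
  define h where "h = min d e / 2"
  have h: "0 < h" "h < d" "h < e" using d e by (auto simp: h_def)
  have "\<exists>z. 0 < z \<and> z < h \<and> f h - f 0 = (h - 0) * f' z"
    by (rule MVT2) (use h f in auto)
  then obtain z where "0 < z" "z < h" "f h - f 0 = h * f' z" by auto
  with e h have "f h > f 0" by (metis diff_gt_0_iff_gt dual_order.strict_trans mult_pos_pos)
  with max[of h] h show False by auto
qed

text \<open>
  If \<open>u\<close> had a positive value, then \<open>u x + \<eta> * (x \<bullet> x)\<close> with small \<open>\<eta> > 0\<close> would attain its
  maximum over \<open>K\<close> in the open set \<open>T\<close>, where its Laplacian \<open>2 * N * \<eta>\<close> is positive; but all
  second derivatives along coordinate lines are nonpositive at an interior maximum.
\<close>

lemma harmonic_max_principle: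
  fixes u :: "'a::euclidean_space \<Rightarrow> real"
  assumes u: "harmonic_on S u" and K: "compact K" "K \<subseteq> S" and T: "open T" "T \<subseteq> K"
    and bd: "\<And>x. x \<in> K - T \<Longrightarrow> u x \<le> 0" and x0: "x0 \<in> K"
  shows "u x0 \<le> 0"
proof (rule ccontr)
  assume "\<not> u x0 \<le> 0"
  then have pos: "u x0 > 0" by simp
  obtain R where R: "R > 0" "\<And>x. x \<in> K \<Longrightarrow> norm x \<le> R"
    using compact_imp_bounded[OF K(1)] bounded_pos by blast
  \<comment> \<open>small enough that the perturbation cannot lift the values on \<open>K - T\<close> above \<open>u x0\<close>\<close>
  define \<eta> where "\<eta> = u x0 / (2 * R\<^sup>2)"
  have \<eta>: "\<eta> > 0" "\<eta> * R\<^sup>2 < u x0" using pos R by (auto simp: \<eta>_def)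
  define v where "v = (\<lambda>x. u x + \<eta> * (x \<bullet> x))"
  have "continuous_on K v" unfolding v_def
    by (intro continuous_intros continuous_on_subset[OF harmonic_on_cont[OF u] K(2)])
  then obtain x1 where x1: "x1 \<in> K" "\<And>x. x \<in> K \<Longrightarrow> v x \<le> v x1"
    using continuous_attains_sup[OF K(1)] x0 by blast
  have "x1 \<in> T"
  proof (rule ccontr)
    assume "x1 \<notin> T"
    then have "u x1 \<le> 0" using bd x1 by auto
    moreover have "\<eta> * (x1 \<bullet> x1) \<le> \<eta> * R\<^sup>2"
      using R(2)[OF x1(1)] \<eta> by (auto simp: power2_norm_eq_inner[symmetric] intro!: mult_left_mono power_mono)
    moreover have "0 \<le> \<eta> * (x0 \<bullet> x0)" using \<eta> by simp
    ultimately have "v x1 < v x0" unfolding v_def using \<eta>(2) by linarith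
    with x1(2)[OF x0] show False by simp
  qed
  then obtain d where d: "d > 0" "ball x1 d \<subseteq> T" using T openE by blast
  have le: "grad (partial_deriv b u) x1 \<bullet> b + 2 * \<eta> \<le> 0" if b: "b \<in> Basis" for b
  proof (rule second_deriv_local_max[OF d(1)])
    have inb: "x1 + t *\<^sub>R b \<in> T" if "\<bar>t\<bar> < d" for t
      using that d b by (auto simp: subset_iff dist_norm)
    show "((\<lambda>t. v (x1 + t *\<^sub>R b)) has_real_derivative
        partial_deriv b u (x1 + t *\<^sub>R b) + 2 * \<eta> * ((x1 + t *\<^sub>R b) \<bullet> b)) (at t)" if "\<bar>t\<bar> < d" for t
    proof -
      have "x1 + t *\<^sub>R b \<in> S" using inb[OF that] T K by auto
      from GDERIV_line[OF harmonic_on_GDERIV[OF u this]]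
      have "((\<lambda>t. u (x1 + t *\<^sub>R b)) has_real_derivative partial_deriv b u (x1 + t *\<^sub>R b)) (at t)"
        by (simp add: grad_inner_Basis[OF b])
      moreover have "((\<lambda>t. \<eta> * ((x1 + t *\<^sub>R b) \<bullet> (x1 + t *\<^sub>R b))) has_real_derivative 2 * \<eta> * ((x1 + t *\<^sub>R b) \<bullet> b)) (at t)"
        unfolding inner_add_left inner_add_right inner_scaleR_left inner_scaleR_right
        by (auto intro!: derivative_eq_intros simp: b algebra_simps inner_commute)
      ultimately show ?thesis unfolding v_def by (rule DERIV_add)
    qed
    show "((\<lambda>t. partial_deriv b u (x1 + t *\<^sub>R b) + 2 * \<eta> * ((x1 + t *\<^sub>R b) \<bullet> b)) has_real_derivative
        grad (partial_deriv b u) x1 \<bullet> b + 2 * \<eta>) (at 0)"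
    proof (rule DERIV_add)
      show "((\<lambda>t. partial_deriv b u (x1 + t *\<^sub>R b)) has_real_derivative grad (partial_deriv b u) x1 \<bullet> b) (at 0)"
        by (rule GDERIV_line) (use harmonic_on_GDERIV2[OF u _ b] x1 K in auto)
      show "((\<lambda>t. 2 * \<eta> * ((x1 + t *\<^sub>R b) \<bullet> b)) has_real_derivative 2 * \<eta>) (at 0)"
        unfolding inner_add_left inner_scaleR_left
        by (auto intro!: derivative_eq_intros simp: b)
    qed
    show "v (x1 + t *\<^sub>R b) \<le> v (x1 + 0 *\<^sub>R b)" if "\<bar>t\<bar> < d" for t
      using x1(2) inb[OF that] T by auto
  qed
  have "(\<Sum>b\<in>Basis. grad (partial_deriv b u) x1 \<bullet> b + 2 * \<eta>) \<le> (\<Sum>b\<in>(Basis::'a set). 0)"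
    by (rule sum_mono) (use le in auto)
  moreover have "(\<Sum>b\<in>Basis. grad (partial_deriv b u) x1 \<bullet> b) = 0"
    using harmonic_on_trace[OF u] x1 K by auto
  ultimately show False using \<eta> by (simp add: sum.distrib mult_le_0_iff)
qed

section \<open>Uniqueness of harmonic continuation from the sphere\<close>

text \<open>
  The reflection principle says nothing on the ray through the singularity. Statements about
  continuous functions extend to that ray because open sets are not contained in a line.
\<close>

lemma open_not_subset_line:
  fixes e :: "'a::euclidean_space"
  assumes "DIM('a) \<ge> 2" "open T" "T \<noteq> {}"
  obtains y where "y \<in> T" "y \<notin> span {e}"
proof -
  have "dim (span {e}) \<le> 1" by (metis card.empty card_insert_disjoint dim_le_card' dim_span empty_iff finite.emptyI finite.insertI One_nat_def)
  then have "interior (span {e}) = {}" using assms by (intro empty_interior_lowdim) auto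
  then have "\<not> T \<subseteq> span {e}" using assms interior_maximal by blast
  then show ?thesis using that by blast
qed

text \<open>
  A bounded singularity is removable. Compare \<open>\<plusminus> u\<close> with \<open>\<epsilon>\<close> times the Newtonian kernel of pole \<open>p\<close>:
  on a sufficiently small sphere around \<open>p\<close> the kernel wins over the bound \<open>M\<close>, on the unit sphere
  \<open>u\<close> vanishes. The maximum principle gives \<open>\<plusminus> u \<le> \<epsilon> * g\<close> in between, and \<open>\<epsilon>\<close> is arbitrary.
\<close>

lemma harmonic_bounded_puncture_eq_0:
  fixes u :: "'a::euclidean_space \<Rightarrow> real"
  assumes u: "harmonic_on (- {p}) u" and N: "DIM('a) \<ge> 3" and p: "p \<in> ball 0 1"
    and u0: "\<And>x. x \<in> sphere 0 1 \<Longrightarrow> u x = 0"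
    and d0: "d0 > 0" and bound: "\<And>x. x \<in> ball p d0 - {p} \<Longrightarrow> \<bar>u x\<bar> \<le> M"
    and x: "x \<in> cball 0 1 - {p}"
  shows "u x = 0"
proof -
  define \<kappa> where "\<kappa> = (real DIM('a) - 2) / 2"
  have \<kappa>: "2 * \<kappa> = real DIM('a) - 2" "\<kappa> > 0" using N by (auto simp: \<kappa>_def)
  define g where "g = (\<lambda>x. ((x - p) \<bullet> (x - p)) powr (- \<kappa>))"
  have g: "harmonic_on (- {p}) g" unfolding g_def by (rule harmonic_newton[OF \<kappa>(1)])
  have le: "c * u x \<le> \<epsilon> * g x" if \<epsilon>: "\<epsilon> > 0" and c: "\<bar>c\<bar> = 1" for \<epsilon> c :: real
  proof -
    \<comment> \<open>enlarged so that it is positive and may be divided by\<close>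
    define M' where "M' = \<bar>M\<bar> + 1"
    \<comment> \<open>the last bound lets \<open>\<epsilon>\<close> times the kernel dominate the bound on \<open>u\<close> at distance \<open>d\<close>\<close>
    define d where "d = min (min (d0 / 2) (dist x p)) ((\<epsilon> / M') powr (1 / (2 * \<kappa>)))"
    have M': "M' > 0" "M \<le> M'" by (auto simp: M'_def)
    have d: "d > 0" "d < d0" "d \<le> dist x p" "d \<le> (\<epsilon> / M') powr (1 / (2 * \<kappa>))"
      using d0 x \<epsilon> M' by (auto simp: d_def)
    have "d powr (2 * \<kappa>) \<le> ((\<epsilon> / M') powr (1 / (2 * \<kappa>))) powr (2 * \<kappa>)"
      using d \<kappa> by (intro powr_mono2) auto
    also have "\<dots> = \<epsilon> / M'" using \<kappa> \<epsilon> M' by (simp add: powr_powr)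
    finally have dM: "M' \<le> \<epsilon> * d powr (- (2 * \<kappa>))"
      using M' d by (simp add: powr_minus field_simps)
    let ?K = "cball 0 1 - ball p d" and ?T = "ball 0 1 - cball p d"
    have h: "harmonic_on (- {p}) (\<lambda>x. c * u x + (- \<epsilon>) * g x)"
      by (intro harmonic_on_add harmonic_on_scale u g)
    have "c * u x + (- \<epsilon>) * g x \<le> 0"
    proof (rule harmonic_max_principle[OF h, of ?K ?T])
      show "compact ?K" by (intro compact_diff compact_cball open_ball)
      show "?K \<subseteq> - {p}" using d by auto
      show "open ?T" by (intro open_Diff open_ball closed_cball)
      show "?T \<subseteq> ?K" by auto
      show "x \<in> ?K" using x d by (auto simp: dist_commute)
      fix y assume y: "y \<in> ?K - ?T"
      have g0: "g y \<ge> 0" by (simp add: g_def)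
      consider "norm y = 1" | "dist p y = d" using y by force
      then show "c * u y + (- \<epsilon>) * g y \<le> 0"
      proof cases
        case 1
        then show ?thesis using u0[of y] g0 \<epsilon> by simp
      next
        case 2
        then have "y \<in> ball p d0 - {p}" using d by auto
        then have "\<bar>c * u y\<bar> \<le> M'" using bound M' c by (fastforce simp: abs_mult)
        moreover have "g y = d powr (- (2 * \<kappa>))"
          using 2 norm_powr_sq[of "y - p" "- \<kappa>"] by (simp add: g_def dist_norm norm_minus_commute)
        ultimately show ?thesis using dM by simp
      qed
    qed
    then show ?thesis by simp
  qed
  have g0: "g x > 0" using x by (simp add: g_def)
  have "c * u x \<le> 0" if "\<bar>c\<bar> = 1" for c :: real
  proof (rule field_le_epsilon)
    fix e :: real assume "e > 0"
    then have "c * u x \<le> (e / g x) * g x" by (intro le that) (simp add: g0)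
    then show "c * u x \<le> 0 + e" using g0 by simp
  qed
  from this[of 1] this[of "-1"] show ?thesis by simp
qed

text \<open>
  Vanishing on the sphere determines \<open>u\<close> only because \<open>u\<close> is harmonic outside the ball too: the Green function
  of the ball with pole \<open>r *\<^sub>R e\<close> vanishes on the sphere, but it is singular at the mirror image
  \<open>e /\<^sub>R r\<close>. Here \<open>u\<close> is regular at this mirror image, so odd reflection bounds \<open>u\<close> near the pole; the
  singularity is removable and \<open>u\<close> vanishes in the ball, and by reflection outside. The pole must differ from
  the origin, whose mirror image is the point at infinity, where nothing is assumed.
\<close>

theorem harmonic_punctured_sphere_unique:
  fixes u :: "'a::euclidean_space \<Rightarrow> real"
  assumes u: "harmonic_on (- {r *\<^sub>R e}) u" and N: "DIM('a) \<ge> 3"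
    and e: "norm e = 1" and r: "0 < r" "r < 1"
    and u0: "\<And>x. x \<in> sphere 0 1 \<Longrightarrow> u x = 0" and x: "x \<noteq> r *\<^sub>R e"
  shows "u x = 0"
proof -
  define p where "p = r *\<^sub>R e"
  define \<kappa> where "\<kappa> = (real DIM('a) - 2) / 2"
  have \<kappa>: "2 * \<kappa> = real DIM('a) - 2" "\<kappa> > 0" using N by (auto simp: \<kappa>_def)
  have up: "harmonic_on (- {p}) u" using u by (simp add: p_def)
  have np: "norm p = r" using e r by (simp add: p_def)
  have cont: "continuous_on (- {p}) u" by (rule harmonic_on_cont[OF up])
  have odd: "u y = - (norm y powr (- (2 * \<kappa>)) * u (y /\<^sub>R (norm y)\<^sup>2))" if y: "y \<notin> span {e}" for y
  proof -
    have y0: "y \<noteq> 0" using y span_zero by blast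
    define w where "w = y /\<^sub>R norm y"
    have yw: "y = norm y *\<^sub>R w" using y0 by (simp add: w_def)
    have w: "w \<in> sphere 0 1" using y0 by (simp add: w_def)
    have ws: "t *\<^sub>R w \<noteq> p" if "t > 0" for t
    proof
      assume "t *\<^sub>R w = p"
      then have "(norm y / t) *\<^sub>R (t *\<^sub>R w) = (norm y / t * r) *\<^sub>R e" by (simp add: p_def)
      then have "y = (norm y / t * r) *\<^sub>R e" using that yw by simp
      then show False using y by (metis span_base span_scale insertI1)
    qed
    have ex: "exp (ln (norm y)) = norm y" "exp (- ln (norm y)) = 1 / norm y"
      using y0 by (auto simp: exp_minus field_simps)
    have 1: "exp (\<kappa> * ln (norm y)) * u (exp (ln (norm y)) *\<^sub>R w) =
        - (exp (- \<kappa> * ln (norm y)) * u (exp (- ln (norm y)) *\<^sub>R w))"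
    proof (rule harmonic_kelvin_odd[OF up _ u0 \<kappa>(1) w])
      show "sphere 0 1 \<subseteq> - {p}" using np r by auto
    qed (use ws in auto)
    have 2: "exp (- ln (norm y)) *\<^sub>R w = y /\<^sub>R (norm y)\<^sup>2"
      unfolding ex w_def by (simp add: power2_eq_square divide_inverse)
    have "exp (\<kappa> * ln (norm y)) * u y = - (exp (- \<kappa> * ln (norm y)) * u (y /\<^sub>R (norm y)\<^sup>2))"
      using 1 unfolding 2 ex(1) yw[symmetric] .
    then have "exp (- (\<kappa> * ln (norm y))) * (exp (\<kappa> * ln (norm y)) * u y) =
      exp (- (\<kappa> * ln (norm y))) * - (exp (- \<kappa> * ln (norm y)) * u (y /\<^sub>R (norm y)\<^sup>2))" by simp
    then have "u y = - (exp (- (\<kappa> * ln (norm y))) * exp (- \<kappa> * ln (norm y)) * u (y /\<^sub>R (norm y)\<^sup>2))"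
      by (simp add: mult.assoc[symmetric] exp_add[symmetric])
    also have "exp (- (\<kappa> * ln (norm y))) * exp (- \<kappa> * ln (norm y)) = norm y powr (- (2 * \<kappa>))"
      using y0 by (simp add: powr_def exp_add[symmetric] algebra_simps)
    finally show ?thesis .
  qed
  \<comment> \<open>the mirror image of the pole: \<open>u\<close> is continuous there, so the right-hand side of \<open>odd\<close> is continuous at \<open>p\<close>\<close>
  define q where "q = p /\<^sub>R (norm p)\<^sup>2"
  have p0: "p \<noteq> 0" using np r by auto
  have "norm q = 1 / r" using r by (simp add: q_def np power2_eq_square field_simps)
  moreover have "1 < 1 / r" using r by simp
  ultimately have "norm q \<noteq> norm p" using np r by linarith
  then have qp: "q \<in> - {p}" by auto
  have "isCont u q"
    using cont qp continuous_on_eq_continuous_at[OF open_Compl[OF closed_singleton], of p u] by blast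
  moreover have "isCont (\<lambda>x. x /\<^sub>R (norm x)\<^sup>2) p" using p0 by (intro continuous_intros) auto
  ultimately have ic: "isCont (\<lambda>x. u (x /\<^sub>R (norm x)\<^sup>2)) p"
    unfolding q_def by (rule isCont_o2[rotated])
  have "isCont (\<lambda>x. norm x powr (- (2 * \<kappa>)) * u (x /\<^sub>R (norm x)\<^sup>2)) p"
    using p0 by (intro continuous_intros ic) auto
  then obtain d0 where d0: "d0 > 0" "\<And>y. dist y p < d0 \<Longrightarrow>
      dist (norm y powr (- (2 * \<kappa>)) * u (y /\<^sub>R (norm y)\<^sup>2)) (norm p powr (- (2 * \<kappa>)) * u (p /\<^sub>R (norm p)\<^sup>2)) < 1"
    unfolding continuous_at_eps_delta using zero_less_one by blast
  define M where "M = \<bar>norm p powr (- (2 * \<kappa>)) * u (p /\<^sub>R (norm p)\<^sup>2)\<bar> + 1"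
  have off: "\<bar>u y\<bar> \<le> M" if "dist y p < d0" "y \<notin> span {e}" for y
    using d0(2)[OF that(1)] odd[OF that(2)] by (auto simp: M_def dist_real_def)
  have bound: "\<bar>u y\<bar> \<le> M" if y: "y \<in> ball p d0 - {p}" for y
  proof (rule ccontr)
    assume *: "\<not> \<bar>u y\<bar> \<le> M"
    have "open {z \<in> ball p d0 - {p}. M < \<bar>u z\<bar>}"
    proof -
      have "open ((ball p d0 - {p}) \<inter> (\<lambda>z. \<bar>u z\<bar>) -` {M<..})"
        by (intro continuous_open_preimage continuous_intros continuous_on_subset[OF cont]) auto
      moreover have "(ball p d0 - {p}) \<inter> (\<lambda>z. \<bar>u z\<bar>) -` {M<..} = {z \<in> ball p d0 - {p}. M < \<bar>u z\<bar>}" by auto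
      ultimately show ?thesis by simp
    qed
    moreover have "{z \<in> ball p d0 - {p}. M < \<bar>u z\<bar>} \<noteq> {}" using y * by (auto simp: not_le)
    ultimately obtain z where "z \<in> {z \<in> ball p d0 - {p}. M < \<bar>u z\<bar>}" "z \<notin> span {e}"
      using N by (elim open_not_subset_line[rotated]) auto
    then show False using off[of z] by (auto simp: dist_commute)
  qed
  have inside: "u y = 0" if "y \<in> cball 0 1 - {p}" for y
    by (rule harmonic_bounded_puncture_eq_0[OF up N _ u0 d0(1) bound that]) (use np r in auto)
  show "u x = 0"
  proof (rule ccontr)
    assume "u x \<noteq> 0"
    have "open ((- {p}) \<inter> u -` (- {0}))"
      by (intro continuous_open_preimage cont) auto
    moreover have "(- {p}) \<inter> u -` (- {0}) \<noteq> {}" using \<open>u x \<noteq> 0\<close> x by (auto simp: p_def)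
    ultimately obtain y where y: "y \<in> (- {p}) \<inter> u -` (- {0})" "y \<notin> span {e}"
      using N by (elim open_not_subset_line[rotated]) auto
    have y1: "norm y > 1" using y inside[of y] by (auto simp: not_le[symmetric])
    have y2: "y /\<^sub>R (norm y)\<^sup>2 \<noteq> p"
    proof
      assume "y /\<^sub>R (norm y)\<^sup>2 = p"
      then have "(norm y)\<^sup>2 *\<^sub>R (y /\<^sub>R (norm y)\<^sup>2) = ((norm y)\<^sup>2 * r) *\<^sub>R e" by (simp add: p_def)
      moreover have "y \<noteq> 0" using y1 by auto
      ultimately have "y = ((norm y)\<^sup>2 * r) *\<^sub>R e" by simp
      then show False using y(2) by (metis span_base span_scale insertI1)
    qed
    have "norm (y /\<^sub>R (norm y)\<^sup>2) \<le> 1" using y1 by (simp add: power2_eq_square field_simps)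
    then have "u (y /\<^sub>R (norm y)\<^sup>2) = 0" using inside y2 by auto
    with odd[OF y(2)] y(1) show False by simp
  qed
qed

section \<open>Gegenbauer polynomials as multipole fields\<close>

lemma power_series_coeff:
  fixes F :: "nat \<Rightarrow> real \<Rightarrow> real"
  assumes d: "d > 0" and F: "\<And>k s. \<bar>s\<bar> < d \<Longrightarrow> (F k has_real_derivative F (Suc k) s) (at s)"
    and c: "\<And>s. \<bar>s\<bar> < d \<Longrightarrow> (\<lambda>k. c k * s ^ k) sums F 0 s"
  shows "c k = F k 0 / fact k"
  using F c
proof (induction k arbitrary: F c)
  case 0
  have "(\<lambda>k. c k * 0 ^ k) sums F 0 0" using 0(2)[of 0] d by simp
  then show ?case by simp
next
  case (Suc k)
  have "diffs c k = F (Suc k) 0 / fact k"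
  proof (rule Suc.IH[where F = "\<lambda>k. F (Suc k)" and c = "diffs c"])
    show "(F (Suc k) has_real_derivative F (Suc (Suc k)) s) (at s)" if "\<bar>s\<bar> < d" for k s
      by (rule Suc.prems(1)[OF that])
    show "(\<lambda>k. diffs c k * s ^ k) sums F (Suc 0) s" if "\<bar>s\<bar> < d" for s
      by (rule termdiffs_sums_strong[of d c "F 0"]) (use that Suc.prems in auto)
  qed
  then have "real (Suc k) * c (Suc k) = F (Suc k) 0 / fact k" by (simp add: diffs_def)
  then have "c (Suc k) = F (Suc k) 0 / fact k / real (Suc k)"
    by (simp add: nonzero_eq_divide_eq mult_ac del: of_nat_Suc)
  then show ?case
    by (simp only: fact_Suc divide_divide_eq_left mult.commute[of "real (Suc k)" "fact k"])
qed

text \<open>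
  With \<open>\<zeta> = exp (\<i> * arccos t)\<close> the polynomial \<open>1 - 2 * t * z + z ^ 2\<close> factors as
  \<open>(1 - \<zeta> * z) * (1 - cnj \<zeta> * z)\<close>. Both factors have positive real part in the unit disc, so the
  product of their principal powers is holomorphic there, and on the real axis it is the generating function.
\<close>

lemma gegenbauer_coeffs_exist:
  fixes t lam :: real
  assumes t: "\<bar>t\<bar> \<le> 1"
  shows "\<exists>c. \<forall>r. \<bar>r\<bar> < 1 \<longrightarrow> (\<lambda>k. c k * r ^ k) sums ((1 - 2 * t * r + r\<^sup>2) powr (- lam))"
proof -
  define \<zeta> where "\<zeta> = Complex t (sqrt (1 - t\<^sup>2))"
  have t2: "t\<^sup>2 \<le> 1" using t by (simp add: abs_square_le_1)
  have nz: "norm \<zeta> = 1" using t2 by (simp add: \<zeta>_def complex_norm)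
  have pos: "1 - w * z \<notin> \<real>\<^sub>\<le>\<^sub>0" if "norm w = 1" "norm z < 1" for w z :: complex
  proof -
    have "Re (w * z) \<le> norm (w * z)" by (rule complex_Re_le_cmod)
    also have "\<dots> < 1" using that by (simp add: norm_mult)
    finally have "Re (1 - w * z) > 0" by simp
    then show ?thesis by (auto simp: complex_nonpos_Reals_iff)
  qed
  define f where "f = (\<lambda>z. (1 - \<zeta> * z) powr (- of_real lam) * (1 - cnj \<zeta> * z) powr (- of_real lam))"
  have hol: "f holomorphic_on ball 0 1"
    unfolding f_def by (intro holomorphic_intros pos) (auto simp: nz)
  have fr: "f (of_real r) = of_real ((1 - 2 * t * r + r\<^sup>2) powr (- lam))" if r: "\<bar>r\<bar> < 1" for r
  proof -
    define w where "w = 1 - \<zeta> * of_real r"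
    have w: "w \<notin> \<real>\<^sub>\<le>\<^sub>0" unfolding w_def by (rule pos) (use nz r in auto)
    then have w0: "w \<noteq> 0" by auto
    have "f (of_real r) = w powr (- of_real lam) * cnj w powr (- of_real lam)"
      by (simp add: f_def w_def)
    also have "\<dots> = exp (- of_real lam * (Ln w + cnj (Ln w)))"
      using w0 by (simp add: powr_def cnj_Ln[OF w] exp_add[symmetric] algebra_simps)
    also have "Ln w + cnj (Ln w) = of_real (2 * ln (norm w))"
      using w0 by (simp add: complex_add_cnj)
    also have "exp (- of_real lam * of_real (2 * ln (norm w))) = complex_of_real (exp (- lam * (2 * ln (norm w))))"
      by (simp add: exp_of_real[symmetric])
    also have "2 * ln (norm w) = ln ((norm w)\<^sup>2)" using w0 by (simp add: ln_realpow)
    also have "(norm w)\<^sup>2 = 1 - 2 * t * r + r\<^sup>2"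
    proof -
      have "(norm w)\<^sup>2 = (1 - t * r)\<^sup>2 + (sqrt (1 - t\<^sup>2) * r)\<^sup>2"
        by (simp add: cmod_power2 w_def \<zeta>_def)
      also have "\<dots> = 1 - 2 * t * r + r\<^sup>2" using t2 by (simp add: power_mult_distrib) (simp add: power2_eq_square algebra_simps)
      finally show ?thesis .
    qed
    finally show ?thesis
    proof -
      assume *: "f (complex_of_real r) = complex_of_real (exp (- lam * ln (1 - 2 * t * r + r\<^sup>2)))"
      have "(norm w)\<^sup>2 > 0" using w0 by simp
      then have "1 - 2 * t * r + r\<^sup>2 \<noteq> 0" using \<open>(norm w)\<^sup>2 = 1 - 2 * t * r + r\<^sup>2\<close> by simp
      with * show ?thesis by (simp add: powr_def)
    qed
  qed
  define c where "c = (\<lambda>n. Re ((deriv ^^ n) f 0 / fact n))"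
  have "(\<lambda>k. c k * r ^ k) sums ((1 - 2 * t * r + r\<^sup>2) powr (- lam))" if r: "\<bar>r\<bar> < 1" for r
  proof -
    have "(\<lambda>n. (deriv ^^ n) f 0 / fact n * (of_real r - 0) ^ n) sums f (of_real r)"
      by (rule holomorphic_power_series[OF hol]) (use r in simp)
    then have "(\<lambda>n. Re ((deriv ^^ n) f 0 / fact n * (of_real r - 0) ^ n)) sums Re (f (of_real r))"
      by (rule sums_Re)
    moreover have "Re (z * (of_real r - 0) ^ n) = Re z * r ^ n" for z n
      by (simp flip: of_real_power)
    ultimately show ?thesis unfolding fr[OF r] c_def by (simp only: Re_complex_of_real)
  qed
  then show ?thesis by blast
qed

text \<open>
  Coefficients of a power series are determined by its sum, so the description in the definition of
  \<^const>\<open>gegenbauer\<close> has exactly one solution.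
\<close>

lemma gegenbauer_sums:
  fixes t r lam :: real
  assumes t: "\<bar>t\<bar> \<le> 1" and r: "\<bar>r\<bar> < 1"
  shows "(\<lambda>k. gegenbauer lam k t * r ^ k) sums ((1 - 2 * t * r + r\<^sup>2) powr (- lam))"
proof -
  let ?P = "\<lambda>c :: nat \<Rightarrow> real. \<forall>r. \<bar>r\<bar> < 1 \<longrightarrow>
        (\<lambda>k. c k * r ^ k) sums ((1 - 2 * t * r + r\<^sup>2) powr (- lam))"
  obtain c where c: "?P c" using gegenbauer_coeffs_exist[OF t] by blast
  have uniq: "c' = c" if "?P c'" for c'
  proof
    fix k
    have "(c' k - c k) = (\<lambda>k s. 0 :: real) k 0 / fact k"
    proof (rule power_series_coeff[of 1 "\<lambda>k s. 0" "\<lambda>k. c' k - c k"])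
      show "(\<lambda>k. (c' k - c k) * s ^ k) sums 0" if s: "\<bar>s\<bar> < 1" for s
      proof -
        have "(\<lambda>k. c' k * s ^ k - c k * s ^ k) sums
            ((1 - 2 * t * s + s\<^sup>2) powr (- lam) - (1 - 2 * t * s + s\<^sup>2) powr (- lam))"
          by (intro sums_diff) (use c \<open>?P c'\<close> s in auto)
        then show ?thesis by (simp add: left_diff_distrib)
      qed
    qed auto
    then show "c' k = c k" by simp
  qed
  have "(THE c. ?P c) = c" by (rule the_equality[where P = ?P, OF c uniq])
  then have "(\<lambda>k. gegenbauer lam k t) = c" by (simp add: gegenbauer_def fun_eq_iff)
  then have "gegenbauer lam k t = c k" for k by (rule fun_cong)
  then show ?thesis using c r by simp
qed

lemma harmonic_on_translate:
  fixes u :: "'a::euclidean_space \<Rightarrow> real"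
  assumes u: "harmonic_on S u" and T: "open T" "\<And>x. x \<in> T \<Longrightarrow> x - p \<in> S"
  shows "harmonic_on T (\<lambda>x. u (x - p))"
proof (rule harmonic_onI[where U = "\<lambda>x. grad u (x - p)" and V = "\<lambda>b x. grad (partial_deriv b u) (x - p)"])
  have tr: "GDERIV (\<lambda>x. w (x - p)) x :> D" if "GDERIV w (x - p) :> D" for w :: "'a \<Rightarrow> real" and x D
    using GDERIV_affine[of w "- p" 1 x D] that by simp
  show "open T" by fact
  show "GDERIV (\<lambda>x. u (x - p)) x :> grad u (x - p)" if "x \<in> T" for x
    by (rule tr[OF harmonic_on_GDERIV[OF u T(2)[OF that]]])
  show "GDERIV (\<lambda>x. grad u (x - p) \<bullet> b) x :> grad (partial_deriv b u) (x - p)"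
    if "x \<in> T" "b \<in> Basis" for x b
    using tr[OF harmonic_on_GDERIV2[OF u T(2)[OF that(1)] that(2)]] by (simp add: grad_inner_Basis[OF that(2)])
  show "continuous_on T (\<lambda>x. grad (partial_deriv b u) (x - p))" if "b \<in> Basis" for b
    by (intro continuous_on_compose2[OF harmonic_on_cont2[OF u that]] continuous_intros) (use T in auto)
  show "(\<Sum>b\<in>Basis. grad (partial_deriv b u) (x - p) \<bullet> b) = 0" if "x \<in> T" for x
    by (rule harmonic_on_trace[OF u T(2)[OF that]])
qed

text \<open>
  The value at \<open>x\<close> of the \<open>l\<close>-th derivative of the Newtonian kernel of pole \<open>s *\<^sub>R e\<close> with respect to
  the pole parameter \<open>s\<close>, at \<open>s = 0\<close>. Each derivative in the pole is minus a
  derivative in \<open>x\<close>, whence the sign.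
\<close>

definition multipole :: "real \<Rightarrow> 'a::euclidean_space \<Rightarrow> nat \<Rightarrow> 'a \<Rightarrow> real" where
  "multipole \<kappa> e l x = (- 1) ^ l * (partial_deriv e ^^ l) (\<lambda>x. (x \<bullet> x) powr (- \<kappa>)) x"

lemma harmonic_multipole_aux:
  fixes e :: "'a::euclidean_space"
  assumes "2 * \<kappa> = real DIM('a) - 2" "e \<in> Basis"
  shows "harmonic_on (- {0}) ((partial_deriv e ^^ l) (\<lambda>x. (x \<bullet> x) powr (- \<kappa>)))"
proof (induction l)
  case 0
  show ?case using harmonic_newton[OF assms(1), of 0] by simp
next
  case (Suc l)
  then show ?case using harmonic_partial_deriv[OF _ assms(2)] by simp
qed

lemma harmonic_multipole:
  fixes e :: "'a::euclidean_space"
  assumes "2 * \<kappa> = real DIM('a) - 2" "e \<in> Basis"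
  shows "harmonic_on (- {p}) (\<lambda>x. multipole \<kappa> e l (x - p))"
  unfolding multipole_def
  by (intro harmonic_on_scale harmonic_on_translate[OF harmonic_multipole_aux[OF assms]]) auto

lemma multipole_pole_deriv:
  fixes e :: "'a::euclidean_space"
  assumes \<kappa>: "2 * \<kappa> = real DIM('a) - 2" "e \<in> Basis" and x: "x - s *\<^sub>R e \<noteq> 0"
  shows "((\<lambda>s. multipole \<kappa> e l (x - s *\<^sub>R e)) has_real_derivative multipole \<kappa> e (Suc l) (x - s *\<^sub>R e)) (at s)"
proof -
  let ?g = "(partial_deriv e ^^ l) (\<lambda>x. (x \<bullet> x) powr (- \<kappa>))"
  have "GDERIV ?g (x + s *\<^sub>R (- e)) :> grad ?g (x + s *\<^sub>R (- e))"
    by (rule harmonic_on_GDERIV[OF harmonic_multipole_aux[OF \<kappa>]]) (use x in simp)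
  from GDERIV_line[OF this, of UNIV]
  have "((\<lambda>s. ?g (x - s *\<^sub>R e)) has_real_derivative - partial_deriv e ?g (x - s *\<^sub>R e)) (at s)"
    by (simp add: grad_inner_Basis[OF \<kappa>(2)])
  from DERIV_cmult[OF this, of "(- 1) ^ l"] show ?thesis
    unfolding multipole_def by simp
qed

lemma multipole_0: "multipole \<kappa> e 0 x = (x \<bullet> x) powr (- \<kappa>)"
  by (simp add: multipole_def)

text \<open>
  The \<open>s\<close>-expansion of the kernel with pole \<open>s *\<^sub>R e\<close> is the Gegenbauer generating function at
  \<open>s / norm x\<close>, by the cosine rule; its coefficients are the derivatives at \<open>s = 0\<close> over factorials.
\<close>

lemma multipole_eq_gegenbauer:
  fixes e x :: "'a::euclidean_space"
  assumes \<kappa>: "2 * \<kappa> = real DIM('a) - 2" "e \<in> Basis" and x: "x \<noteq> 0"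
  shows "multipole \<kappa> e l x = fact l * (gegenbauer \<kappa> l ((x /\<^sub>R norm x) \<bullet> e) / norm x powr (real l + 2 * \<kappa>))"
proof -
  define t where "t = (x /\<^sub>R norm x) \<bullet> e"
  have ne: "norm e = 1" using \<kappa>(2) by simp
  have t: "\<bar>t\<bar> \<le> 1" using Cauchy_Schwarz_ineq2[of "x /\<^sub>R norm x" e] x ne by (simp add: t_def)
  have xe: "x \<bullet> e = norm x * t" using x by (simp add: t_def)
  have nx: "norm x > 0" using x by simp
  have "norm x powr (- (2 * \<kappa>)) * gegenbauer \<kappa> l t / norm x ^ l = multipole \<kappa> e l (x - 0 *\<^sub>R e) / fact l"
  proof (rule power_series_coeff[OF nx, of "\<lambda>k s. multipole \<kappa> e k (x - s *\<^sub>R e)"])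
    fix k :: nat and s :: real assume s: "\<bar>s\<bar> < norm x"
    have "x - s *\<^sub>R e \<noteq> 0" using s ne by auto
    then show "((\<lambda>s. multipole \<kappa> e k (x - s *\<^sub>R e)) has_real_derivative multipole \<kappa> e (Suc k) (x - s *\<^sub>R e)) (at s)"
      by (rule multipole_pole_deriv[OF \<kappa>])
  next
    fix s :: real assume s: "\<bar>s\<bar> < norm x"
    define r where "r = s / norm x"
    have r: "\<bar>r\<bar> < 1" using s nx by (simp add: r_def)
    have sr: "s = norm x * r" using nx by (simp add: r_def)
    have "(x - s *\<^sub>R e) \<bullet> (x - s *\<^sub>R e) = (norm x)\<^sup>2 - 2 * s * (x \<bullet> e) + s\<^sup>2"
      using ne unfolding power2_norm_eq_inner norm_eq_1
      by (simp add: inner_diff_left inner_diff_right inner_commute[of e x] power2_eq_square algebra_simps)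
    also have "\<dots> = (norm x)\<^sup>2 * (1 - 2 * t * r + r\<^sup>2)"
      unfolding xe sr by (simp add: power2_eq_square algebra_simps)
    finally have 1: "(x - s *\<^sub>R e) \<bullet> (x - s *\<^sub>R e) = (norm x)\<^sup>2 * (1 - 2 * t * r + r\<^sup>2)" .
    then have "0 \<le> (norm x)\<^sup>2 * (1 - 2 * t * r + r\<^sup>2)" by (metis inner_ge_zero)
    then have "0 \<le> 1 - 2 * t * r + r\<^sup>2" using nx by (simp add: zero_le_mult_iff)
    then have 2: "multipole \<kappa> e 0 (x - s *\<^sub>R e) = norm x powr (- (2 * \<kappa>)) * (1 - 2 * t * r + r\<^sup>2) powr (- \<kappa>)"
      unfolding multipole_0 1 using nx norm_powr_sq[of x "- \<kappa>"]
      by (simp add: powr_mult power2_norm_eq_inner)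
    have "(\<lambda>k. norm x powr (- (2 * \<kappa>)) * (gegenbauer \<kappa> k t * r ^ k)) sums
        (norm x powr (- (2 * \<kappa>)) * (1 - 2 * t * r + r\<^sup>2) powr (- \<kappa>))"
      by (intro sums_mult gegenbauer_sums t r)
    then show "(\<lambda>k. (norm x powr (- (2 * \<kappa>)) * gegenbauer \<kappa> k t / norm x ^ k) * s ^ k) sums multipole \<kappa> e 0 (x - s *\<^sub>R e)"
      unfolding 2 by (simp add: r_def power_divide mult_ac)
  qed
  moreover have "norm x powr (real l + 2 * \<kappa>) = norm x ^ l * norm x powr (2 * \<kappa>)"
    using nx by (simp add: powr_add powr_realpow)
  ultimately show ?thesis
    unfolding t_def[symmetric] using nx by (simp add: powr_minus field_simps)
qed

section \<open>The Poisson wavelet and its continuation\<close>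

text \<open>
  The Poisson kernel is \<open>1 + \<rho> \<partial>\<^sub>\<rho> / \<lambda>\<close> applied to the Newtonian kernel of pole \<open>\<rho> *\<^sub>R e\<close>: for
  \<open>q = 1 - 2 * \<rho> * (e \<bullet> y) + \<rho> ^ 2\<close> the numerator becomes
  \<open>q - \<rho> * (2 * \<rho> - 2 * (e \<bullet> y)) = 1 - \<rho> ^ 2\<close>.
\<close>

lemma poisson_kernel_eq_multipole:
  fixes e y :: "'a::euclidean_space"
  assumes N: "real DIM('a) = real n + 1" "n \<ge> 2" and lam: "lam = (real n - 1) / 2"
    and e: "e \<in> Basis" and y: "norm y = 1" and \<rho>: "0 < \<rho>" "\<rho> < 1"
  shows "poisson_kernel n e \<rho> y =
     1 / sphere_area n * (multipole lam e 0 (y - \<rho> *\<^sub>R e) + \<rho> * multipole lam e 1 (y - \<rho> *\<^sub>R e) / lam)"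
proof -
  have \<kappa>: "2 * lam = real DIM('a) - 2" "lam > 0" using N lam by auto
  have ne: "norm e = 1" using e by simp
  define q where "q = (\<lambda>\<rho>. 1 - 2 * \<rho> * (e \<bullet> y) + \<rho>\<^sup>2)"
  have q: "(y - \<rho> *\<^sub>R e) \<bullet> (y - \<rho> *\<^sub>R e) = q \<rho>" for \<rho>
    using ne y unfolding norm_eq_1
    by (simp add: q_def inner_diff_left inner_diff_right inner_commute[of y e] power2_eq_square algebra_simps)
  have ny: "y - \<rho> *\<^sub>R e \<noteq> 0" using y ne \<rho> by auto
  have q0: "q \<rho> > 0" using ny q[of \<rho>] by (metis inner_gt_zero_iff)
  have "((\<lambda>\<rho>. q \<rho> powr (- lam)) has_real_derivative (- lam * q \<rho> powr (- lam - 1)) * (2 * \<rho> - 2 * (e \<bullet> y))) (at \<rho>)"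
  proof (rule DERIV_chain2[where f = "\<lambda>z. z powr (- lam)"])
    show "(q has_real_derivative 2 * \<rho> - 2 * (e \<bullet> y)) (at \<rho>)"
      unfolding q_def by (auto intro!: derivative_eq_intros)
  qed (rule has_real_derivative_powr[OF q0])
  moreover have "((\<lambda>\<rho>. multipole lam e 0 (y - \<rho> *\<^sub>R e)) has_real_derivative multipole lam e (Suc 0) (y - \<rho> *\<^sub>R e)) (at \<rho>)"
    by (rule multipole_pole_deriv[OF \<kappa>(1) e ny])
  ultimately have m1: "multipole lam e 1 (y - \<rho> *\<^sub>R e) = (- lam * q \<rho> powr (- lam - 1)) * (2 * \<rho> - 2 * (e \<bullet> y))"
    unfolding multipole_0 q by (simp add: DERIV_unique)
  have "q \<rho> powr (- lam) = q \<rho> powr (- lam - 1) * q \<rho>"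
    using powr_add[of "q \<rho>" "- lam - 1" 1]
    by (simp only: diff_add_cancel powr_one[OF less_imp_le[OF q0]])
  then have "multipole lam e 0 (y - \<rho> *\<^sub>R e) + \<rho> * multipole lam e 1 (y - \<rho> *\<^sub>R e) / lam =
      q \<rho> powr (- lam - 1) * (q \<rho> - 2 * \<rho>\<^sup>2 + 2 * \<rho> * (e \<bullet> y))"
    unfolding m1 multipole_0 q using \<kappa>(2) by (simp add: power2_eq_square field_simps)
  also have "q \<rho> - 2 * \<rho>\<^sup>2 + 2 * \<rho> * (e \<bullet> y) = 1 - \<rho>\<^sup>2" by (simp add: q_def)
  also have "- lam - 1 = - ((real n + 1) / 2)" by (simp add: lam field_simps)
  finally show ?thesis unfolding poisson_kernel_def q_def by (simp add: powr_minus_divide)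
qed

text \<open>
  The numbers \<open>alpha l m\<close> are the Stirling numbers of the second kind. With \<open>A l\<close> standing for
  \<open>\<rho> ^ l\<close> times an \<open>l\<close>-th derivative, \<open>real l * A l + A (Suc l)\<close> is the effect of \<open>\<rho> \<partial>\<^sub>\<rho>\<close> on
  \<open>A l\<close>, and the recursion of \<open>alpha\<close> rearranges the sum. The range may extend
  beyond \<open>m\<close>, where the coefficients vanish.
\<close>

lemma alpha_sum_step:
  fixes A :: "nat \<Rightarrow> real"
  assumes "m \<le> K"
  shows "(\<Sum>l\<le>K. alpha l m * (real l * A l + A (Suc l))) = (\<Sum>l\<le>Suc K. alpha l (Suc m) * A l)"
proof -
  have "(\<Sum>l\<le>Suc K. alpha l (Suc m) * A l) = (\<Sum>l\<le>K. (real (Suc l) * alpha (Suc l) m + alpha l m) * A (Suc l))"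
    by (subst sum.atMost_Suc_shift) simp
  also have "\<dots> = (\<Sum>l\<le>K. real (Suc l) * alpha (Suc l) m * A (Suc l)) + (\<Sum>l\<le>K. alpha l m * A (Suc l))"
    by (simp add: distrib_right sum.distrib)
  also have "(\<Sum>l\<le>K. real (Suc l) * alpha (Suc l) m * A (Suc l)) = (\<Sum>l\<le>Suc K. real l * alpha l m * A l)"
    by (subst sum.atMost_Suc_shift) simp
  also have "\<dots> = (\<Sum>l\<le>K. real l * alpha l m * A l)" using assms by (simp add: alpha_eq_0)
  finally show ?thesis by (simp add: sum.distrib[symmetric] algebra_simps)
qed

text \<open>
  \<open>E m\<close> is the expansion of \<open>(\<rho> \<partial>\<^sub>\<rho>) ^ m\<close> applied to \<open>\<Phi> 0\<close>. The function \<open>P\<close> is \<open>E 0 + E 1 / lam\<close> up to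
  the constant \<open>C\<close>, so \<open>m\<close> Euler derivatives raise both indices by \<open>m\<close>; this is the origin of the two terms
  in each coefficient.
\<close>

lemma euler_op_iter_poisson:
  fixes P :: "real \<Rightarrow> real" and \<Phi> :: "nat \<Rightarrow> real \<Rightarrow> real"
  assumes \<Phi>: "\<And>l \<rho>. 0 < \<rho> \<Longrightarrow> \<rho> < 1 \<Longrightarrow> (\<Phi> l has_real_derivative \<Phi> (Suc l) \<rho>) (at \<rho>)"
    and P: "\<And>\<rho>. 0 < \<rho> \<Longrightarrow> \<rho> < 1 \<Longrightarrow> P \<rho> = C * (\<Phi> 0 \<rho> + \<rho> * \<Phi> 1 \<rho> / lam)"
    and \<rho>: "0 < \<rho>" "\<rho> < 1"
  shows "(euler_op ^^ m) P \<rho> = C * (\<Sum>l\<le>Suc m. (alpha l m + alpha l (Suc m) / lam) * \<rho> ^ l * \<Phi> l \<rho>)"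
proof -
  define E where "E = (\<lambda>m \<rho>. \<Sum>l\<le>m. alpha l m * (\<rho> ^ l * \<Phi> l \<rho>))"
  have E': "\<exists>D. (E m has_real_derivative D) (at \<rho>) \<and> \<rho> * D = E (Suc m) \<rho>" if \<rho>: "0 < \<rho>" "\<rho> < 1" for m \<rho>
  proof -
    let ?D = "\<Sum>l\<le>m. alpha l m * (real l * \<rho> ^ (l - 1) * \<Phi> l \<rho> + \<rho> ^ l * \<Phi> (Suc l) \<rho>)"
    have "(E m has_real_derivative ?D) (at \<rho>)" unfolding E_def
      by (intro DERIV_sum DERIV_cmult) (auto intro!: derivative_eq_intros \<Phi> \<rho>)
    moreover have "\<rho> * ?D = (\<Sum>l\<le>m. alpha l m * (real l * (\<rho> ^ l * \<Phi> l \<rho>) + \<rho> ^ Suc l * \<Phi> (Suc l) \<rho>))"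
      unfolding sum_distrib_left
    proof (intro sum.cong refl)
      fix l
      show "\<rho> * (alpha l m * (real l * \<rho> ^ (l - 1) * \<Phi> l \<rho> + \<rho> ^ l * \<Phi> (Suc l) \<rho>)) =
         alpha l m * (real l * (\<rho> ^ l * \<Phi> l \<rho>) + \<rho> ^ Suc l * \<Phi> (Suc l) \<rho>)"
        by (cases l) (simp_all add: algebra_simps)
    qed
    then have "\<rho> * ?D = E (Suc m) \<rho>"
      unfolding E_def using alpha_sum_step[of m m "\<lambda>l. \<rho> ^ l * \<Phi> l \<rho>"] by simp
    ultimately show ?thesis by blast
  qed
  have "\<forall>\<rho>\<in>{0<..<1}. (euler_op ^^ m) P \<rho> = C * (E m \<rho> + E (Suc m) \<rho> / lam)"
  proof (induction m)
    case 0
    then show ?case using P by (simp add: E_def)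
  next
    case (Suc m)
    show ?case
    proof
      fix \<rho> :: real assume r: "\<rho> \<in> {0<..<1}"
      obtain D1 D2 where D: "(E m has_real_derivative D1) (at \<rho>)" "\<rho> * D1 = E (Suc m) \<rho>"
         "(E (Suc m) has_real_derivative D2) (at \<rho>)" "\<rho> * D2 = E (Suc (Suc m)) \<rho>"
        using E'[of \<rho> m] E'[of \<rho> "Suc m"] r by auto
      have "((\<lambda>\<rho>. C * (E m \<rho> + E (Suc m) \<rho> / lam)) has_real_derivative C * (D1 + D2 / lam)) (at \<rho>)"
        by (intro DERIV_cmult DERIV_add DERIV_cdivide D)
      then have "((euler_op ^^ m) P has_real_derivative C * (D1 + D2 / lam)) (at \<rho>)"
        by (rule has_field_derivative_transform_within_open[of _ _ _ "{0<..<1}"]) (use r Suc in auto)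
      then have "(euler_op ^^ Suc m) P \<rho> = \<rho> * (C * (D1 + D2 / lam))"
        by (simp add: euler_op_def DERIV_imp_deriv)
      also have "\<dots> = C * (\<rho> * D1 + \<rho> * D2 / lam)" by (simp add: algebra_simps)
      finally show "(euler_op ^^ Suc m) P \<rho> = C * (E (Suc m) \<rho> + E (Suc (Suc m)) \<rho> / lam)"
        by (simp only: D)
    qed
  qed
  then have "(euler_op ^^ m) P \<rho> = C * (E m \<rho> + E (Suc m) \<rho> / lam)" using \<rho> by simp
  also have "E m \<rho> = (\<Sum>l\<le>Suc m. alpha l m * (\<rho> ^ l * \<Phi> l \<rho>))" by (simp add: E_def alpha_eq_0)
  also have "\<dots> + E (Suc m) \<rho> / lam = (\<Sum>l\<le>Suc m. (alpha l m + alpha l (Suc m) / lam) * \<rho> ^ l * \<Phi> l \<rho>)"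
    unfolding E_def sum_divide_distrib sum.distrib[symmetric]
    by (intro sum.cong refl) (simp add: algebra_simps)
  finally show ?thesis .
qed

theorem proposition4p1:
  fixes n m :: nat and a r lam :: real and k :: "'d::finite" and e :: "real ^ 'd"
  assumes dim: "CARD('d) = n + 1"
    and n: "n \<ge> 2"
    and lam: "lam = (real n - 1) / 2"
    and m: "m \<ge> 1"
    and a: "a > 0"
    and r: "r = exp (- a)"
    and e: "e = axis k 1"
  shows "\<exists>h :: real ^ 'd \<Rightarrow> real.
      harmonic_continuation (sphere 0 1) (- {r *\<^sub>R e}) (poisson_wavelet n e m a) h \<and>
      (\<forall>h'. harmonic_continuation (sphere 0 1) (- {r *\<^sub>R e}) (poisson_wavelet n e m a) h' \<longrightarrow>
            (\<forall>x\<in>- {r *\<^sub>R e}. h' x = h x)) \<and>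
      (\<forall>x\<in>- {r *\<^sub>R e}. h x =
         a ^ m / sphere_area n *
         (\<Sum>l = 0..m + 1. fact l * (alpha l m + alpha l (m + 1) / lam) * exp (- a * real l) *
            (gegenbauer lam l (((x - r *\<^sub>R e) /\<^sub>R norm (x - r *\<^sub>R e)) \<bullet> e) /
             norm (x - r *\<^sub>R e) powr (real l + 2 * lam))))"
proof -
  have eB: "e \<in> Basis" unfolding e by simp
  have ne: "norm e = 1" using eB by simp
  have N: "real DIM(real ^ 'd) = real n + 1" using dim by simp
  have \<kappa>: "2 * lam = real DIM(real ^ 'd) - 2" using N lam by simp
  have r01: "0 < r" "r < 1" using a r by auto
  define p where "p = r *\<^sub>R e"
  have sub: "sphere 0 1 \<subseteq> - {p}" using r01 ne by (auto simp: p_def)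
  define \<beta> where "\<beta> = (\<lambda>l. (alpha l m + alpha l (Suc m) / lam) * r ^ l)"
  define h where "h = (\<lambda>x. a ^ m / sphere_area n * (\<Sum>l\<le>Suc m. \<beta> l * multipole lam e l (x - p)))"
  have harm: "harmonic_on (- {p}) h" unfolding h_def
    by (intro harmonic_on_scale harmonic_on_sum harmonic_multipole \<kappa> eB) auto
  have wav: "h y = poisson_wavelet n e m a y" if y: "y \<in> sphere 0 1" for y
  proof -
    have "(euler_op ^^ m) (\<lambda>r. poisson_kernel n e r y) r = 1 / sphere_area n *
        (\<Sum>l\<le>Suc m. (alpha l m + alpha l (Suc m) / lam) * r ^ l * multipole lam e l (y - r *\<^sub>R e))"
    proof (rule euler_op_iter_poisson[OF _ _ r01])
      fix \<rho> :: real assume \<rho>: "0 < \<rho>" "\<rho> < 1"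
      have "y - \<rho> *\<^sub>R e \<noteq> 0" using y ne \<rho> by auto
      then show "((\<lambda>\<rho>. multipole lam e l (y - \<rho> *\<^sub>R e)) has_real_derivative multipole lam e (Suc l) (y - \<rho> *\<^sub>R e)) (at \<rho>)" for l
        by (rule multipole_pole_deriv[OF \<kappa> eB])
      show "poisson_kernel n e \<rho> y = 1 / sphere_area n *
          (multipole lam e 0 (y - \<rho> *\<^sub>R e) + \<rho> * multipole lam e 1 (y - \<rho> *\<^sub>R e) / lam)"
        by (rule poisson_kernel_eq_multipole[OF N n lam eB _ \<rho>]) (use y in simp)
    qed
    then show ?thesis unfolding poisson_wavelet_def h_def r[symmetric] by (simp add: \<beta>_def p_def)
  qed
  have cont: "harmonic_continuation (sphere 0 1) (- {p}) (poisson_wavelet n e m a) h"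
    using sub harm wav by (simp add: harmonic_continuation_def)
  have uniq: "h' x = h x"
    if h': "harmonic_continuation (sphere 0 1) (- {p}) (poisson_wavelet n e m a) h'" and x: "x \<in> - {p}" for h' x
  proof -
    have "harmonic_on (- {r *\<^sub>R e}) (\<lambda>x. h' x + (- 1) * h x)"
      using h' harm unfolding harmonic_continuation_def p_def
      by (intro harmonic_on_add harmonic_on_scale) auto
    then have "h' x + (- 1) * h x = 0"
      by (rule harmonic_punctured_sphere_unique[OF _ _ ne r01])
        (use h' wav x dim n in \<open>auto simp: harmonic_continuation_def p_def\<close>)
    then show ?thesis by simp
  qed
  have form: "h x = a ^ m / sphere_area n *
         (\<Sum>l = 0..m + 1. fact l * (alpha l m + alpha l (m + 1) / lam) * exp (- a * real l) *
            (gegenbauer lam l (((x - p) /\<^sub>R norm (x - p)) \<bullet> e) /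
             norm (x - p) powr (real l + 2 * lam)))" if x: "x \<in> - {p}" for x
  proof -
    have xp: "x - p \<noteq> 0" using x by simp
    have "r ^ l = exp (- a * real l)" for l
      unfolding r by (simp add: exp_of_nat2_mult[symmetric])
    then show ?thesis
      unfolding h_def \<beta>_def multipole_eq_gegenbauer[OF \<kappa> eB xp] atLeast0AtMost
      by (simp add: mult_ac)
  qed
  show ?thesis
    using cont uniq form unfolding p_def by blast
qed

end
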